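(* Let $\mathcal H$ be an infinite-dimensional complex Hilbert space, let $k$ be a positive integer, and let $\mathbf A=(A_1,\dots,A_m)$ be an $m$-tuple of bounded self-adjoint operators on $\mathcal H$. Then $$\operatorname{cl}(\operatorname{conv}W_k(\mathbf A))=\operatorname{conv}(\operatorname{cl}W_k(\mathbf A))=\operatorname{conv}\mathcal S,\qquad\text{where}\quad \mathcal S=\bigcup_{0\le\ell\le k}\big(W_\ell(\mathbf A)+(k-\ell)W_{\rm ess}(\mathbf A)\big).$$ Consequently, $\operatorname{conv}W_k(\mathbf A)$ is closed if and only if $$W_\ell(\mathbf A)+(k-\ell)W_{\rm ess}(\mathbf A)\subseteq\operatorname{conv}W_k(\mathbf A)\qquad\text{for }\ell=0,\dots,k-1.$$
   Context: For an $m$-tuple $\mathbf B=(B_1,\dots,B_m)$ of bounded operators on a complex Hilbert space $\mathcal H$ and a positive integer $k\le\dim\mathcal H$, the joint $k$-numerical range is $$W_k(\mathbf B)=\Big\{\Big(\sum_{\ell=1}^k\langle B_1x_\ell,x_\ell\rangle,\dots,\sum_{\ell=1}^k\langle B_mx_\ell,x_\ell\rangle\Big):\{x_1,\dots,x_k\}\subseteq\mathcal H\text{ orthonormal}\Big\},$$ with the convention $W_0(\mathbf B)=\{(0,\dots,0)\}$; $W_1$ is written $W$. The joint essential numerical range of $\mathbf A$ is $W_{\rm ess}(\mathbf A)=\bigcap\{\operatorname{cl}W(A_1+K_1,\dots,A_m+K_m):K_1,\dots,K_m\text{ compact operators on }\mathcal H\}$. Here $\operatorname{cl}$ and $\operatorname{conv}$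 denote closure and convex hull, sums of sets are Minkowski sums, and $cS=\{cs:s\in S\}$ for a number $c$ and a set $S$. *)

theory Defs
  imports "HOL-Analysis.Analysis" "HOL-Library.Set_Algebras"
begin

text \<open>Complex inner product spaces. The norm and topology are those of the underlying real inner
  product, which is the real part of the complex one; positive definiteness of \<open>cinner\<close> is
  inherited from \<^class>\<open>real_inner\<close>. The form is linear in its first argument.\<close>

class complex_inner = real_inner +
  fixes scaleC :: "complex \<Rightarrow> 'a \<Rightarrow> 'a" (infixr "*\<^sub>C" 75)
    and cinner :: "'a \<Rightarrow> 'a \<Rightarrow> complex"
  assumes scaleC_add_right: "c *\<^sub>C (x + y) = c *\<^sub>C x + c *\<^sub>C y"
    and scaleC_add_left: "(c + d) *\<^sub>C x = c *\<^sub>C x + d *\<^sub>C x"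
    and scaleC_scaleC: "c *\<^sub>C (d *\<^sub>C x) = (c * d) *\<^sub>C x"
    and scaleR_scaleC: "r *\<^sub>R x = complex_of_real r *\<^sub>C x"
    and cinner_commute: "cinner x y = cnj (cinner y x)"
    and cinner_add_left: "cinner (x + y) z = cinner x z + cinner y z"
    and cinner_scaleC_left: "cinner (c *\<^sub>C x) y = c * cinner x y"
    and inner_eq_Re_cinner: "inner x y = Re (cinner x y)"

class chilbert_space = complex_inner + complete_space

lemma vector_space_scaleC: "vector_space (scaleC :: complex \<Rightarrow> 'a \<Rightarrow> 'a::complex_inner)"
proof
  fix x :: 'a
  show "1 *\<^sub>C x = x"
    using scaleR_scaleC[of 1 x] by simp
qed (simp_all add: scaleC_add_right scaleC_add_left scaleC_scaleC)

lemma cinner_self: "cinner x x = complex_of_real ((norm x)\<^sup>2)"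
proof (rule complex_eqI)
  show "Re (cinner x x) = Re (complex_of_real ((norm x)\<^sup>2))"
    by (simp add: power2_norm_eq_inner inner_eq_Re_cinner)
  show "Im (cinner x x) = Im (complex_of_real ((norm x)\<^sup>2))"
    using arg_cong[OF cinner_commute[of x x], of Im] by simp
qed

instantiation complex :: chilbert_space
begin

definition "scaleC_complex (c::complex) (x::complex) = c * x"
definition "cinner_complex (x::complex) (y::complex) = x * cnj y"

instance
  by standard
    (auto simp: scaleC_complex_def cinner_complex_def algebra_simps scaleR_conv_of_real
      inner_complex_def)

end

definition cfinite_dim :: "'a::complex_inner itself \<Rightarrow> bool" where
  "cfinite_dim _ \<longleftrightarrow>
     (\<exists>B :: 'a set. finite B \<and> module.span scaleC B = UNIV)"

definition bounded_clinear :: "('a::complex_inner \<Rightarrow> 'b::complex_inner) \<Rightarrow> bool" where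
  "bounded_clinear T \<longleftrightarrow> bounded_linear T \<and> (\<forall>c x. T (c *\<^sub>C x) = c *\<^sub>C T x)"

definition selfadjoint :: "('a::complex_inner \<Rightarrow> 'a) \<Rightarrow> bool" where
  "selfadjoint T \<longleftrightarrow> (\<forall>x y. cinner (T x) y = cinner x (T y))"

definition compact_operator :: "('a::complex_inner \<Rightarrow> 'b::complex_inner) \<Rightarrow> bool" where
  "compact_operator T \<longleftrightarrow> bounded_clinear T \<and> compact (closure (T ` cball 0 1))"

definition orthonormal_family :: "nat \<Rightarrow> (nat \<Rightarrow> 'a::complex_inner) \<Rightarrow> bool" where
  "orthonormal_family k x \<longleftrightarrow> (\<forall>i<k. \<forall>j<k. cinner (x i) (x j) = (if i = j then 1 else 0))"

text \<open>The vectors \<open>x\<^sub>1, \<dots>, x\<^sub>k\<close> are indexed from \<open>0\<close> here. For \<open>k = 0\<close> the sum is empty, which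
  yields the convention \<open>W\<^sub>0(B) = {0}\<close> (see \<open>joint_num_range_0\<close>).\<close>

definition joint_num_range ::
  "nat \<Rightarrow> ('m::finite \<Rightarrow> 'a::complex_inner \<Rightarrow> 'a) \<Rightarrow> (complex ^ 'm) set" where
  "joint_num_range k B =
     {(\<chi> j. \<Sum>l<k. cinner (B j (x l)) (x l)) | x. orthonormal_family k x}"

lemma joint_num_range_0: "joint_num_range 0 B = {0}"
  by (auto simp: joint_num_range_def orthonormal_family_def vec_eq_iff)

definition joint_ess_num_range ::
  "('m::finite \<Rightarrow> 'a::complex_inner \<Rightarrow> 'a) \<Rightarrow> (complex ^ 'm) set" where
  "joint_ess_num_range A =
     (\<Inter>K \<in> {K :: 'm \<Rightarrow> 'a \<Rightarrow> 'a. \<forall>j. compact_operator (K j)}.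
        closure (joint_num_range 1 (\<lambda>j x. A j x + K j x)))"

end

theory Submission
  imports Defs
begin

text \<open>Only convex hulls have to be compared. A limit point of \<open>W\<^sub>k(A)\<close> comes from orthonormal
  families \<open>x\<^sub>i\<close> converging weakly (along a filter) to vectors \<open>w\<^sub>i\<close>. The remainders
  \<open>x\<^sub>i - w\<^sub>i\<close> are weakly null with squared norm tending to \<open>1 - \<parallel>w\<^sub>i\<parallel>\<^sup>2\<close>, so the limit is
  \<open>\<Sum> \<langle>A w\<^sub>i, w\<^sub>i\<rangle> + \<Sum> (1 - \<parallel>w\<^sub>i\<parallel>\<^sup>2) s\<^sub>i\<close> with \<open>s\<^sub>i\<close> in the essential range. Diagonalising the
  positive contraction \<open>\<Sum> w\<^sub>i w\<^sub>i\<^sup>*\<close> turns this into a convex combination of points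
  \<open>\<Sum>\<^bsub>i \<in> I\<^esub> \<langle>A e\<^sub>i, e\<^sub>i\<rangle> + (k - |I|) p\<close> with \<open>p\<close> in the convex hull of the essential range.
  Conversely, a finite-rank perturbation shows that the essential range lies in the closed convex
  hull of the values of \<open>A\<close> on unit vectors orthogonal to any given finite orthonormal family, which
  allows such a family to be extended one vector at a time.\<close>

interpretation complex_vector: vector_space "scaleC :: complex \<Rightarrow> 'a \<Rightarrow> 'a::complex_inner"
  by (rule vector_space_scaleC)

section \<open>Complex inner products and orthonormal families\<close>

lemma cinner_add_right: "cinner x (y + z) = cinner x y + cinner x z"
  by (metis cinner_add_left cinner_commute complex_cnj_add)

lemma cinner_scaleC_right: "cinner x (c *\<^sub>C y) = cnj c * cinner x y"
  by (metis cinner_commute cinner_scaleC_left complex_cnj_mult)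

lemma cinner_scaleR_left: "cinner (r *\<^sub>R x) y = r *\<^sub>R cinner x y"
  by (metis cinner_scaleC_left scaleR_conv_of_real scaleR_scaleC)

lemma cinner_scaleR_right: "cinner x (r *\<^sub>R y) = r *\<^sub>R cinner x y"
  by (metis cinner_scaleC_right complex_cnj_complex_of_real scaleR_conv_of_real scaleR_scaleC)

text \<open>The norm comes from the underlying real inner product, so homogeneity under complex
  scalars has to be recovered from \<open>cinner_self\<close>.\<close>

lemma norm_scaleC: "norm (c *\<^sub>C x) = norm c * norm (x :: 'a::complex_inner)"
proof -
  have "complex_of_real ((norm (c *\<^sub>C x))\<^sup>2) = c * cnj c * complex_of_real ((norm x)\<^sup>2)"
    by (simp only: cinner_self[symmetric] cinner_scaleC_left cinner_scaleC_right ac_simps)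
  also have "\<dots> = complex_of_real ((norm c * norm x)\<^sup>2)"
    by (simp add: complex_norm_square[symmetric] power_mult_distrib)
  finally have "(norm (c *\<^sub>C x))\<^sup>2 = (norm c * norm x)\<^sup>2"
    by (rule of_real_eq_iff[THEN iffD1])
  then show ?thesis
    by (simp add: power2_eq_iff_nonneg)
qed

text \<open>Multiplying \<open>x\<close> by a phase turns the complex form into its modulus, where
  the real Cauchy-Schwarz inequality applies.\<close>

lemma norm_cinner_le: "norm (cinner x y) \<le> norm x * norm (y :: 'a::complex_inner)"
proof -
  \<comment> \<open>If the form vanishes then \<open>c = 0\<close>, so what holds in every case is
    \<open>norm c \<le> 1\<close>.\<close>
  define c where "c = cnj (sgn (cinner x y))"
  have "complex_of_real (norm (cinner x y)) = c * cinner x y"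
    using complex_norm_square[of "cinner x y"]
    by (cases "cinner x y = 0")
       (simp_all add: c_def sgn_div_norm scaleR_conv_of_real divide_simps power2_eq_square
          mult.commute)
  then have "norm (cinner x y) = inner (c *\<^sub>C x) y"
    by (metis Re_complex_of_real cinner_scaleC_left inner_eq_Re_cinner)
  also have "\<dots> \<le> norm (c *\<^sub>C x) * norm y"
    by (rule norm_cauchy_schwarz)
  also have "\<dots> \<le> norm x * norm y"
    by (intro mult_right_mono) (auto simp: norm_scaleC c_def norm_sgn)
  finally show ?thesis .
qed

interpretation bounded_bilinear_cinner:
  bounded_bilinear "cinner :: 'a::complex_inner \<Rightarrow> 'a \<Rightarrow> complex"
  by standard
     (auto simp: cinner_add_left cinner_add_right cinner_scaleR_left cinner_scaleR_right
       intro!: exI[of _ 1] norm_cinner_le)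

interpretation bounded_bilinear_scaleC:
  bounded_bilinear "scaleC :: complex \<Rightarrow> 'a::complex_inner \<Rightarrow> 'a"
  by standard
     (auto simp: scaleC_add_left scaleC_add_right scaleR_scaleC[where 'a = 'a] scaleC_scaleC
       norm_scaleC scaleR_conv_of_real mult.commute intro!: exI[of _ 1])

lemmas cinner_simps = bounded_bilinear_cinner.zero_left bounded_bilinear_cinner.zero_right
  bounded_bilinear_cinner.diff_left bounded_bilinear_cinner.diff_right
  bounded_bilinear_cinner.sum_left bounded_bilinear_cinner.sum_right
  cinner_add_left cinner_add_right cinner_scaleC_left cinner_scaleC_right
  cinner_scaleR_left cinner_scaleR_right

lemma cinner_mult_commute: "cinner x y * cinner y x = complex_of_real ((norm (cinner x y))\<^sup>2)"
  by (metis cinner_commute complex_norm_square)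

lemma cinner_self_eq_1_iff: "cinner x x = 1 \<longleftrightarrow> norm (x :: 'a::complex_inner) = 1"
proof -
  have "cinner x x = 1 \<longleftrightarrow> (norm x)\<^sup>2 = 1"
    unfolding cinner_self by (metis of_real_1 of_real_eq_iff)
  then show ?thesis
    by (simp add: power2_eq_1_iff) (use norm_ge_zero[of x] in linarith)
qed

lemma cinner_eq_0_commute: "cinner x y = 0 \<longleftrightarrow> cinner y x = 0"
  by (metis cinner_commute complex_cnj_zero)

lemma norm_add_sq_orthogonal:
  fixes x y :: "'a::complex_inner"
  assumes "cinner x y = 0"
  shows "(norm (x + y))\<^sup>2 = (norm x)\<^sup>2 + (norm y)\<^sup>2"
proof -
  have "inner x y = 0"
    using assms by (simp add: inner_eq_Re_cinner)
  then show ?thesis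
    by (simp add: power2_norm_eq_inner inner_add_left inner_add_right inner_commute)
qed

lemma orthonormal_familyD:
  "orthonormal_family k e \<Longrightarrow> i < k \<Longrightarrow> j < k \<Longrightarrow> cinner (e i) (e j) = (if i = j then 1 else 0)"
  by (simp add: orthonormal_family_def)

lemma orthonormal_family_norm: "orthonormal_family k e \<Longrightarrow> i < k \<Longrightarrow> norm (e i) = 1"
  by (simp add: cinner_self_eq_1_iff[symmetric] orthonormal_familyD)

lemma orthonormal_family_0 [simp]: "orthonormal_family 0 e"
  by (simp add: orthonormal_family_def)

lemma orthonormal_family_Suc:
  assumes "orthonormal_family k e" "norm u = 1" "\<And>i. i < k \<Longrightarrow> cinner u (e i) = 0"
  shows "orthonormal_family (Suc k) (e(k := u))"
  using assms cinner_eq_0_commute[of _ u]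
  by (auto simp: orthonormal_family_def less_Suc_eq cinner_self_eq_1_iff)

section \<open>Orthogonal projections and Bessel's inequality\<close>

definition orthoproj :: "nat \<Rightarrow> (nat \<Rightarrow> 'a::complex_inner) \<Rightarrow> 'a \<Rightarrow> 'a" where
  "orthoproj k e v = (\<Sum>i<k. cinner v (e i) *\<^sub>C e i)"

lemma sum_mult_if_delta:
  fixes f :: "nat \<Rightarrow> complex"
  assumes "i < k"
  shows "(\<Sum>j<k. f j * (if j = i then 1 else 0)) = f i"
proof -
  have "(\<Sum>j<k. f j * (if j = i then 1 else 0)) = (\<Sum>j<k. if j = i then f j else 0)"
    by (intro sum.cong) auto
  then show ?thesis
    using assms by simp
qed

lemma cinner_orthoproj:
  assumes "orthonormal_family k e" "i < k"
  shows "cinner (orthoproj k e v) (e i) = cinner v (e i)"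
proof -
  have "cinner (orthoproj k e v) (e i) = (\<Sum>j<k. cinner v (e j) * (if j = i then 1 else 0))"
    unfolding orthoproj_def cinner_simps
    by (intro sum.cong) (use assms in \<open>auto simp: orthonormal_familyD\<close>)
  then show ?thesis
    using assms by (simp only: sum_mult_if_delta)
qed

lemma cinner_residual:
  assumes "orthonormal_family k e" "i < k"
  shows "cinner (v - orthoproj k e v) (e i) = 0"
  by (simp add: cinner_simps cinner_orthoproj[OF assms])

lemma cinner_orthoproj_orthogonal:
  assumes "\<And>i. i < k \<Longrightarrow> cinner u (e i) = 0"
  shows "cinner u (orthoproj k e v) = 0"
  using assms by (simp add: orthoproj_def cinner_simps)

lemma norm_orthoproj_sq:
  fixes e :: "nat \<Rightarrow> 'a::complex_inner"
  assumes "orthonormal_family k e"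
  shows "(norm (orthoproj k e v))\<^sup>2 = (\<Sum>i<k. (norm (cinner v (e i)))\<^sup>2)"
proof -
  have "complex_of_real ((norm (orthoproj k e v))\<^sup>2) = cinner (orthoproj k e v) (orthoproj k e v)"
    by (rule cinner_self[symmetric])
  also have "\<dots> = (\<Sum>i<k. cnj (cinner v (e i)) * cinner (orthoproj k e v) (e i))"
    by (subst (2) orthoproj_def) (simp add: cinner_simps)
  also have "\<dots> = (\<Sum>i<k. complex_of_real ((norm (cinner v (e i)))\<^sup>2))"
    by (intro sum.cong refl)
       (simp add: cinner_orthoproj[OF assms] complex_norm_square mult.commute del: of_real_power)
  finally show ?thesis
    by (simp only: of_real_sum[symmetric] of_real_eq_iff)
qed

text \<open>Pythagoras for the orthogonal splitting of \<open>v\<close> into residual and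
  projection.\<close>

lemma bessel:
  fixes e :: "nat \<Rightarrow> 'a::complex_inner"
  assumes "orthonormal_family k e"
  shows "(\<Sum>i<k. (norm (cinner v (e i)))\<^sup>2) \<le> (norm v)\<^sup>2"
proof -
  have "cinner (v - orthoproj k e v) (orthoproj k e v) = 0"
    by (rule cinner_orthoproj_orthogonal) (rule cinner_residual[OF assms])
  from norm_add_sq_orthogonal[OF this] show ?thesis
    by (simp add: norm_orthoproj_sq[OF assms])
qed

section \<open>Orthonormal bases and finite-dimensional subspaces\<close>

lemma orthonormal_family_independent:
  assumes "orthonormal_family k e"
  shows "complex_vector.independent (e ` {..<k})" "inj_on e {..<k}"
proof -
  show inj: "inj_on e {..<k}"
  proof
    fix i j assume "i \<in> {..<k}" "j \<in> {..<k}" "e i = e j"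
    then show "i = j"
      using orthonormal_familyD[OF assms, of i j] orthonormal_familyD[OF assms, of j j]
      by (auto split: if_splits)
  qed
  show "complex_vector.independent (e ` {..<k})"
  proof (rule complex_vector.independent_if_scalars_zero)
    fix f x assume s: "(\<Sum>x\<in>e ` {..<k}. f x *\<^sub>C x) = 0" and "x \<in> e ` {..<k}"
    then obtain i where i: "x = e i" "i < k"
      by auto
    have "0 = cinner (\<Sum>j<k. f (e j) *\<^sub>C e j) (e i)"
      using s by (simp add: sum.reindex[OF inj] cinner_simps)
    also have "\<dots> = (\<Sum>j<k. f (e j) * (if j = i then 1 else 0))"
      unfolding cinner_simps
      by (intro sum.cong) (use i assms in \<open>auto simp: orthonormal_familyD\<close>)
    finally show "f x = 0"
      using i by (simp only: sum_mult_if_delta)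
  qed auto
qed

text \<open>Independence bounds the length of orthonormal families in \<open>S\<close> by
  \<open>card B\<close>, so a longest one exists and cannot be extended. \<open>S\<close> is an
  arbitrary set so that it can be a subspace or a set of eigenvectors.\<close>

lemma maximal_orthonormal_family:
  fixes S :: "'a::complex_inner set"
  assumes "finite B" "S \<subseteq> complex_vector.span B"
  obtains l e where "l \<le> card B" "orthonormal_family l e" "e ` {..<l} \<subseteq> S"
    "\<And>u. u \<in> S \<Longrightarrow> norm u = 1 \<Longrightarrow> \<exists>i<l. cinner u (e i) \<noteq> 0"
proof -
  define P where "P l \<longleftrightarrow> (\<exists>e. orthonormal_family l e \<and> e ` {..<l} \<subseteq> S)" for l
  have bound: "l \<le> card B" if P: "P l" for l
  proof -
    obtain e where e: "orthonormal_family l e" "e ` {..<l} \<subseteq> S"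
      using P unfolding P_def by blast
    have "card (e ` {..<l}) \<le> card B"
      using complex_vector.independent_span_bound[OF assms(1) orthonormal_family_independent(1)[OF e(1)]]
        e(2) assms(2) by blast
    then show ?thesis
      by (simp add: card_image orthonormal_family_independent(2)[OF e(1)])
  qed
  have P0: "P 0"
    by (simp add: P_def)
  define l where "l = (GREATEST l. P l)"
  have "P l"
    unfolding l_def by (rule GreatestI_nat[of P 0 "card B"]) (use P0 bound in auto)
  then obtain e where e: "orthonormal_family l e" "e ` {..<l} \<subseteq> S"
    unfolding P_def by blast
  show thesis
  proof (rule that[of l e])
    show "\<exists>i<l. cinner u (e i) \<noteq> 0" if u: "u \<in> S" "norm u = 1" for u
    proof (rule ccontr)
      assume "\<not> ?thesis"
      then have "orthonormal_family (Suc l) (e(l := u))"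
        using orthonormal_family_Suc[OF e(1) u(2)] by blast
      moreover have "(e(l := u)) ` {..<Suc l} \<subseteq> S"
        using e(2) u(1) by (auto simp: less_Suc_eq)
      ultimately have "P (Suc l)"
        unfolding P_def by blast
      then have "Suc l \<le> l"
        unfolding l_def by (rule Greatest_le_nat[of P _ "card B"]) (use bound in auto)
      then show False
        by simp
    qed
  qed (use e \<open>P l\<close> bound in auto)
qed

lemma normalize_unit:
  fixes u :: "'a::real_normed_vector"
  shows "u \<noteq> 0 \<Longrightarrow> norm ((1 / norm u) *\<^sub>R u) = 1"
  by simp

lemma subspace_scaleR:
  "complex_vector.subspace V \<Longrightarrow> v \<in> V \<Longrightarrow> r *\<^sub>R v \<in> V"
  by (simp add: scaleR_scaleC complex_vector.subspace_scale)

lemma subspace_orthoproj: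
  "complex_vector.subspace V \<Longrightarrow> e ` {..<l} \<subseteq> V \<Longrightarrow> orthoproj l e v \<in> V"
  unfolding orthoproj_def
  by (intro complex_vector.subspace_sum complex_vector.subspace_scale) auto

text \<open>Take a maximal family: a nonzero residual of some \<open>v\<close> in \<open>V\<close>,
  once normalised, would extend it.\<close>

lemma orthonormal_basis_exists:
  fixes V :: "'a::complex_inner set"
  assumes "finite B" "V \<subseteq> complex_vector.span B" "complex_vector.subspace V"
  obtains l e where "l \<le> card B" "orthonormal_family l e" "e ` {..<l} \<subseteq> V"
    "\<And>v. v \<in> V \<Longrightarrow> orthoproj l e v = v"
proof -
  obtain l e where e: "l \<le> card B" "orthonormal_family l e" "e ` {..<l} \<subseteq> V"
    and max: "\<And>u. u \<in> V \<Longrightarrow> norm u = 1 \<Longrightarrow> \<exists>i<l. cinner u (e i) \<noteq> 0"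
    using maximal_orthonormal_family[OF assms(1,2)] by metis
  have "orthoproj l e v = v" if v: "v \<in> V" for v
  proof (rule ccontr)
    assume "orthoproj l e v \<noteq> v"
    then have ne: "v - orthoproj l e v \<noteq> 0"
      by simp
    have "v - orthoproj l e v \<in> V"
      by (intro complex_vector.subspace_diff assms(3) v subspace_orthoproj e(3))
    then have "(1 / norm (v - orthoproj l e v)) *\<^sub>R (v - orthoproj l e v) \<in> V"
      by (rule subspace_scaleR[OF assms(3)])
    from max[OF this normalize_unit[OF ne]] show False
      using cinner_residual[OF e(2)] by (auto simp: cinner_scaleR_left)
  qed
  then show thesis
    using that e by blast
qed

text \<open>Infinite dimension supplies a vector outside the span of \<open>S\<close>; its residual
  after projection is nonzero and orthogonal to \<open>S\<close>.\<close>

lemma exists_unit_orthogonal: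
  assumes "\<not> cfinite_dim TYPE('a::complex_inner)" "finite (S :: 'a set)"
  obtains u where "norm u = 1" "\<And>v. v \<in> S \<Longrightarrow> cinner u v = 0"
proof -
  let ?V = "complex_vector.span S"
  obtain l e where e: "orthonormal_family l e" and p: "\<And>v. v \<in> ?V \<Longrightarrow> orthoproj l e v = v"
    and eV: "e ` {..<l} \<subseteq> ?V"
    using orthonormal_basis_exists[OF assms(2) order_refl complex_vector.subspace_span] by metis
  obtain x where x: "x \<notin> ?V"
    using assms unfolding cfinite_dim_def by blast
  define r where "r = x - orthoproj l e x"
  have "orthoproj l e x \<in> ?V"
    by (rule subspace_orthoproj[OF complex_vector.subspace_span eV])
  then have "r \<noteq> 0"
    using x by (auto simp: r_def)
  have "cinner r v = 0" if "v \<in> S" for v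
  proof -
    have "cinner r (orthoproj l e v) = 0"
      by (rule cinner_orthoproj_orthogonal) (simp add: r_def cinner_residual[OF e])
    then show ?thesis
      using p[OF complex_vector.span_base[OF that]] by simp
  qed
  then show thesis
    using that[of "(1 / norm r) *\<^sub>R r"] normalize_unit[OF \<open>r \<noteq> 0\<close>]
    by (simp add: cinner_scaleR_left)
qed

text \<open>The combinations of an orthonormal basis with coefficients in the closed unit disc form
  a Minkowski sum of compact sets. By Cauchy-Schwarz the unit sphere of \<open>V\<close> is a closed
  part of it.\<close>

lemma compact_unit_sphere_finite_dim:
  fixes V :: "'a::complex_inner set"
  assumes "finite B" "V \<subseteq> complex_vector.span B" "complex_vector.subspace V"
  shows "compact (V \<inter> sphere 0 1)"
proof -
  obtain l e where e: "orthonormal_family l e" "e ` {..<l} \<subseteq> V"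
    "\<And>v. v \<in> V \<Longrightarrow> orthoproj l e v = v"
    using orthonormal_basis_exists[OF assms] by metis
  define S where "S n = {\<Sum>i<n. c i *\<^sub>C e i | c. \<forall>i<n. norm (c i) \<le> 1}" for n
  have cpt: "compact (S n)" for n
  proof (induction n)
    case 0
    then show ?case by (auto simp: S_def)
  next
    case (Suc n)
    let ?C = "(\<lambda>c. c *\<^sub>C e n) ` cball 0 1"
    have "compact ?C"
      by (intro compact_continuous_image compact_cball continuous_intros
          bounded_linear.continuous_on[OF bounded_bilinear_scaleC.bounded_linear_left])
    with Suc have "compact {x + y | x y. x \<in> S n \<and> y \<in> ?C}"
      by (rule compact_sums)
    also have "{x + y | x y. x \<in> S n \<and> y \<in> ?C} = S (Suc n)"
    proof safe
      fix x y and d :: complex assume "x \<in> S n" and d: "d \<in> cball 0 1"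
      then obtain c where c: "x = (\<Sum>i<n. c i *\<^sub>C e i)" "\<forall>i<n. norm (c i) \<le> 1"
        by (auto simp: S_def)
      have "x + d *\<^sub>C e n = (\<Sum>i<Suc n. (c(n := d)) i *\<^sub>C e i)"
        using c by simp
      moreover have "\<forall>i<Suc n. norm ((c(n := d)) i) \<le> 1"
        using c d by (auto simp: less_Suc_eq)
      ultimately show "x + d *\<^sub>C e n \<in> S (Suc n)"
        unfolding S_def by blast
    next
      fix x assume "x \<in> S (Suc n)"
      then obtain c where c: "x = (\<Sum>i<Suc n. c i *\<^sub>C e i)" "\<forall>i<Suc n. norm (c i) \<le> 1"
        by (auto simp: S_def)
      then show "\<exists>xa y. x = xa + y \<and> xa \<in> S n \<and> y \<in> ?C"
        by (intro exI[of _ "\<Sum>i<n. c i *\<^sub>C e i"] exI[of _ "c n *\<^sub>C e n"])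
           (auto simp: S_def)
    qed
    finally show ?case .
  qed
  have "V \<inter> sphere 0 1 = S l \<inter> sphere 0 1"
  proof safe
    fix v :: 'a assume v: "v \<in> V" "v \<in> sphere 0 1"
    have "norm (cinner v (e i)) \<le> 1" if "i < l" for i
      using norm_cinner_le[of v "e i"] v orthonormal_family_norm[OF e(1) that] by simp
    then show "v \<in> S l"
      using e(3)[OF v(1)] unfolding S_def orthoproj_def by force
  next
    fix v :: 'a assume "v \<in> S l"
    then show "v \<in> V"
      using e(2) unfolding S_def
      by (auto intro!: complex_vector.subspace_sum complex_vector.subspace_scale assms(3))
  qed
  moreover have "closed (sphere (0 :: 'a) 1)"
    unfolding sphere_def by (intro closed_Collect_eq continuous_intros)
  ultimately show ?thesis
    using compact_Int_closed[OF cpt[of l], of "sphere 0 1"] by simp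
qed

section \<open>The spectral theorem for a finite-rank operator\<close>

lemma bounded_clinearD:
  assumes "bounded_clinear T"
  shows "bounded_linear T" "T (c *\<^sub>C x) = c *\<^sub>C T x"
  using assms by (auto simp: bounded_clinear_def)

lemma bounded_clinear_simps:
  assumes "bounded_clinear T"
  shows "T 0 = 0" "T (x + y) = T x + T y" "T (x - y) = T x - T y" "T (r *\<^sub>R x) = r *\<^sub>R T x"
    "T (\<Sum>i\<in>I. f i) = (\<Sum>i\<in>I. T (f i))"
proof -
  interpret bounded_linear T
    using assms by (rule bounded_clinearD)
  show "T 0 = 0" "T (x + y) = T x + T y" "T (x - y) = T x - T y" "T (r *\<^sub>R x) = r *\<^sub>R T x"
    "T (\<Sum>i\<in>I. f i) = (\<Sum>i\<in>I. T (f i))"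
    by (rule zero add diff scaleR sum)+
qed

text \<open>A maximiser \<open>v\<close> of the quadratic form of \<open>T\<close> on the compact
  unit sphere of \<open>V\<close> is an eigenvector: otherwise moving it slightly towards the
  component of \<open>T v\<close> orthogonal to \<open>v\<close> would increase the Rayleigh
  quotient.\<close>

lemma exists_eigenvector:
  fixes V :: "'a::complex_inner set"
  assumes V: "finite B" "V \<subseteq> complex_vector.span B" "complex_vector.subspace V" "V \<noteq> {0}"
    and T: "bounded_clinear T" "\<And>x. x \<in> V \<Longrightarrow> T x \<in> V"
    and sa: "\<And>x y. cinner (T x) y = cinner x (T y)"
  obtains v where "v \<in> V" "norm v = 1" "T v = cinner (T v) v *\<^sub>C v"
proof -
  note Tsimps = bounded_clinear_simps[OF T(1)]
  define f where "f v = Re (cinner (T v) v)" for v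
  have "continuous_on (V \<inter> sphere 0 1) f"
    unfolding f_def
    by (intro continuous_intros bounded_bilinear_cinner.continuous_on
        bounded_linear.continuous_on[OF bounded_clinearD(1)[OF T(1)]])
  moreover have "V \<inter> sphere 0 1 \<noteq> {}"
  proof -
    obtain x where "x \<in> V" "x \<noteq> 0"
      using V(3,4) complex_vector.subspace_0 by blast
    then have "(1 / norm x) *\<^sub>R x \<in> V \<inter> sphere 0 1"
      using subspace_scaleR[OF V(3)] by simp
    then show ?thesis
      by blast
  qed
  ultimately obtain v where v: "v \<in> V" "norm v = 1"
    and max: "\<And>x. x \<in> V \<Longrightarrow> norm x = 1 \<Longrightarrow> f x \<le> f v"
    using continuous_attains_sup[OF compact_unit_sphere_finite_dim[OF V(1-3)]] by fastforce
  \<comment> \<open>Homogeneity carries the bound from the unit sphere to all of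
    \<open>V\<close>.\<close>
  have scale: "f (r *\<^sub>R x) = r\<^sup>2 * f x" for r x
    by (simp add: f_def Tsimps cinner_simps power2_eq_square)
  have le: "f x \<le> f v * (norm x)\<^sup>2" if "x \<in> V" for x
  proof (cases "x = 0")
    case False
    then have "f ((1 / norm x) *\<^sub>R x) \<le> f v"
      using that by (intro max subspace_scaleR V) auto
    then show ?thesis
      using False by (simp only: scale) (simp add: field_simps)
  qed (simp add: f_def Tsimps cinner_simps)
  have fv: "cinner (T v) v = complex_of_real (f v)"
  proof (rule complex_eqI)
    have "cinner (T v) v = cnj (cinner (T v) v)"
      using sa cinner_commute by metis
    then have "Im (cinner (T v) v) = - Im (cinner (T v) v)"
      by (metis cnj.simps(2))
    then show "Im (cinner (T v) v) = Im (complex_of_real (f v))"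
      by simp
  qed (simp add: f_def)
  \<comment> \<open>The residual of the eigenvalue equation. It is orthogonal to \<open>v\<close>,
    so along \<open>v + d *\<^sub>R u\<close> the squared norm changes only to second order in
    \<open>d\<close>, whereas \<open>f\<close> gains the first-order term
    \<open>2 * d * a\<close>.\<close>
  define u where "u = T v - f v *\<^sub>R v"
  have uV: "u \<in> V"
    unfolding u_def by (intro complex_vector.subspace_diff subspace_scaleR V T v)
  have uv: "cinner u v = 0"
    using v by (simp add: u_def cinner_simps fv cinner_self scaleR_conv_of_real)
  have Tvu: "Re (cinner (T v) u) = (norm u)\<^sup>2"
  proof -
    have "T v = u + f v *\<^sub>R v"
      by (simp add: u_def)
    then show ?thesis
      using uv cinner_eq_0_commute[of u v] by (simp add: cinner_simps cinner_self)
  qed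
  have Tuv: "Re (cinner (T u) v) = (norm u)\<^sup>2"
    using Tvu by (metis sa cinner_commute complex_cnj cnj.simps(1))
  have "u = 0"
  proof (rule ccontr)
    assume "u \<noteq> 0"
    define a where "a = (norm u)\<^sup>2"
    define C where "C = f v * a - f u"
    \<comment> \<open>Maximality will give \<open>2 * a \<le> d * C\<close>; this \<open>d\<close>
      makes the right side at most \<open>a\<close>. The summand 1 keeps the denominator
      positive.\<close>
    define d where "d = a / (\<bar>C\<bar> + 1)"
    have "a > 0"
      using \<open>u \<noteq> 0\<close> by (simp add: a_def)
    then have "d > 0"
      unfolding d_def by (intro divide_pos_pos) auto
    have "f (v + d *\<^sub>R u) \<le> f v * (norm (v + d *\<^sub>R u))\<^sup>2"
      by (intro le complex_vector.subspace_add subspace_scaleR V v uV)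
    moreover have "f (v + d *\<^sub>R u) = f v + 2 * d * a + d\<^sup>2 * f u"
      by (simp add: f_def Tsimps cinner_simps Tvu Tuv a_def power2_eq_square algebra_simps)
    moreover have "(norm (v + d *\<^sub>R u))\<^sup>2 = 1 + d\<^sup>2 * a"
    proof -
      have "cinner v (d *\<^sub>R u) = 0"
        using uv cinner_eq_0_commute[of u v] by (simp add: cinner_simps)
      from norm_add_sq_orthogonal[OF this] show ?thesis
        using v by (simp add: a_def power_mult_distrib)
    qed
    ultimately have "d * (2 * a) \<le> d * (d * C)"
      by (simp add: C_def power2_eq_square algebra_simps)
    then have "2 * a \<le> d * C"
      using \<open>d > 0\<close> by simp
    also have "\<dots> \<le> d * (\<bar>C\<bar> + 1)"
      using \<open>d > 0\<close> by (intro mult_left_mono) auto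
    also have "\<dots> = a"
      by (simp add: d_def)
    finally show False
      using \<open>a > 0\<close> by simp
  qed
  then have "T v = f v *\<^sub>R v"
    by (simp add: u_def)
  then have "T v = cinner (T v) v *\<^sub>C v"
    by (metis fv scaleR_scaleC)
  with v show thesis
    using that by blast
qed

text \<open>Take a maximal orthonormal family of eigenvectors in \<open>V\<close>. Its orthogonal
  complement in \<open>V\<close> is invariant because \<open>T\<close> is symmetric, so if it were
  nonzero it would contain a further eigenvector.\<close>

lemma orthonormal_eigenbasis_exists:
  fixes V :: "'a::complex_inner set"
  assumes V: "finite B" "V \<subseteq> complex_vector.span B" "complex_vector.subspace V"
    and T: "bounded_clinear T" "\<And>x. x \<in> V \<Longrightarrow> T x \<in> V"
    and sa: "\<And>x y. cinner (T x) y = cinner x (T y)"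
  obtains l e where "l \<le> card B" "orthonormal_family l e"
    "\<And>i. i < l \<Longrightarrow> T (e i) = cinner (T (e i)) (e i) *\<^sub>C e i"
    "\<And>v. v \<in> V \<Longrightarrow> orthoproj l e v = v"
proof -
  define S where "S = {v \<in> V. T v = cinner (T v) v *\<^sub>C v}"
  have "S \<subseteq> complex_vector.span B"
    using V by (auto simp: S_def)
  then obtain l e where e: "l \<le> card B" "orthonormal_family l e" "e ` {..<l} \<subseteq> S"
    and max: "\<And>u. u \<in> S \<Longrightarrow> norm u = 1 \<Longrightarrow> \<exists>i<l. cinner u (e i) \<noteq> 0"
    using maximal_orthonormal_family[OF V(1)] by metis
  have eig: "T (e i) = cinner (T (e i)) (e i) *\<^sub>C e i" and eV: "e i \<in> V" if "i < l" for i
    using e(3) that by (auto simp: S_def)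
  define V' where "V' = {v \<in> V. \<forall>i<l. cinner v (e i) = 0}"
  have V': "V' \<subseteq> complex_vector.span B" "complex_vector.subspace V'"
    using V by (auto simp: V'_def complex_vector.subspace_def cinner_simps)
  have TV': "T x \<in> V'" if "x \<in> V'" for x
    using that eig T(2) by (auto simp: V'_def sa) (metis cinner_scaleC_right mult_zero_right)
  have "V' = {0}"
  proof (rule ccontr)
    assume "V' \<noteq> {0}"
    then obtain v where "v \<in> V'" "norm v = 1" "T v = cinner (T v) v *\<^sub>C v"
      using exists_eigenvector[OF V(1) V' _ T(1) TV' sa] by metis
    then show False
      using max[of v] by (auto simp: S_def V'_def)
  qed
  moreover have "v - orthoproj l e v \<in> V'" if "v \<in> V" for v
    using that eV cinner_residual[OF e(2)]
    by (auto simp: V'_def intro!: complex_vector.subspace_diff V(3) subspace_orthoproj)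
  ultimately have "orthoproj l e v = v" if "v \<in> V" for v
    using that by auto
  then show thesis
    using that e eig by blast
qed

lemma bounded_clinear_rank1: "bounded_clinear (\<lambda>v. cinner v a *\<^sub>C b)"
  unfolding bounded_clinear_def
  by (auto simp: cinner_simps
      intro!: bounded_linear_compose[OF bounded_bilinear_scaleC.bounded_linear_left
        bounded_bilinear_cinner.bounded_linear_left])

lemma bounded_clinear_sum:
  "(\<And>i. i \<in> I \<Longrightarrow> bounded_clinear (f i)) \<Longrightarrow> bounded_clinear (\<lambda>v. \<Sum>i\<in>I. f i v)"
  unfolding bounded_clinear_def
  by (auto intro!: bounded_linear_sum simp: complex_vector.scale_sum_right)

text \<open>The eigenvectors of \<open>v \<mapsto> \<Sum>\<^sub>j \<langle>v, w\<^sub>j\<rangle> w\<^sub>j\<close> diagonalise the Gram matrix of \<open>w\<close>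
  without a unitary change of coordinates; the number \<open>\<Sum>\<^sub>j \<bar>\<langle>e\<^sub>i, w\<^sub>j\<rangle>\<bar>\<^sup>2\<close> is the eigenvalue of \<open>e\<^sub>i\<close>.\<close>

lemma sum_quadratic_form_diagonalization:
  fixes w :: "nat \<Rightarrow> 'a::complex_inner"
  obtains l e where "l \<le> k" "orthonormal_family l e"
    "\<And>B. bounded_clinear B \<Longrightarrow> (\<Sum>j<k. cinner (B (w j)) (w j)) =
      (\<Sum>i<l. (\<Sum>j<k. (norm (cinner (e i) (w j)))\<^sup>2) *\<^sub>R cinner (B (e i)) (e i))"
proof -
  define T where "T v = (\<Sum>j<k. cinner v (w j) *\<^sub>C w j)" for v
  define V where "V = complex_vector.span (w ` {..<k})"
  have T: "bounded_clinear T"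
    unfolding T_def by (intro bounded_clinear_sum bounded_clinear_rank1)
  have TV: "T x \<in> V" for x
    unfolding T_def V_def
    by (intro complex_vector.span_sum complex_vector.span_scale complex_vector.span_base) auto
  have sa: "cinner (T x) y = cinner x (T y)" for x y
    by (auto simp: T_def cinner_simps cinner_commute[of y] intro!: sum.cong)
  obtain l e where e: "l \<le> card (w ` {..<k})" "orthonormal_family l e"
    and eig: "\<And>i. i < l \<Longrightarrow> T (e i) = cinner (T (e i)) (e i) *\<^sub>C e i"
    and p: "\<And>v. v \<in> V \<Longrightarrow> orthoproj l e v = v"
    using orthonormal_eigenbasis_exists[of "w ` {..<k}" V T] T TV sa
    by (auto simp: V_def complex_vector.subspace_span)
  have t: "cinner (T v) v = complex_of_real (\<Sum>j<k. (norm (cinner v (w j)))\<^sup>2)" for v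
    by (simp add: T_def cinner_simps cinner_mult_commute)
  have "(\<Sum>j<k. cinner (B (w j)) (w j)) =
      (\<Sum>i<l. (\<Sum>j<k. (norm (cinner (e i) (w j)))\<^sup>2) *\<^sub>R cinner (B (e i)) (e i))"
    if B: "bounded_clinear B" for B
  proof -
    \<comment> \<open>\<open>B\<close> is linear and each \<open>w j\<close> is its own expansion in
      the eigenbasis.\<close>
    have Bw: "B (w j) = (\<Sum>i<l. cinner (w j) (e i) *\<^sub>C B (e i))" if "j < k" for j
    proof -
      have "w j \<in> V"
        using that by (auto simp: V_def intro: complex_vector.span_base)
      then have "B (w j) = B (orthoproj l e (w j))"
        by (simp add: p)
      then show ?thesis
        by (simp add: orthoproj_def bounded_clinear_simps[OF B] bounded_clinearD(2)[OF B])
    qed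
    have "(\<Sum>j<k. cinner (B (w j)) (w j)) =
        (\<Sum>j<k. \<Sum>i<l. cinner (w j) (e i) * cinner (B (e i)) (w j))"
      by (intro sum.cong refl) (simp add: Bw cinner_simps)
    also have "\<dots> = (\<Sum>i<l. \<Sum>j<k. cinner (w j) (e i) * cinner (B (e i)) (w j))"
      by (rule sum.swap)
    \<comment> \<open>Summing over \<open>j\<close> first reassembles \<open>T (e i)\<close>, which
      is a multiple of \<open>e i\<close>; this removes all off-diagonal terms.\<close>
    also have "\<dots> = (\<Sum>i<l. cinner (B (e i)) (T (e i)))"
      by (intro sum.cong refl) (simp add: T_def cinner_simps flip: cinner_commute)
    also have "\<dots> = (\<Sum>i<l. (\<Sum>j<k. (norm (cinner (e i) (w j)))\<^sup>2) *\<^sub>R cinner (B (e i)) (e i))"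
    proof (intro sum.cong refl)
      fix i assume "i \<in> {..<l}"
      then have "cinner (B (e i)) (T (e i)) = cnj (cinner (T (e i)) (e i)) * cinner (B (e i)) (e i)"
        using eig[of i] by (metis cinner_scaleC_right lessThan_iff)
      then show "cinner (B (e i)) (T (e i)) =
          (\<Sum>j<k. (norm (cinner (e i) (w j)))\<^sup>2) *\<^sub>R cinner (B (e i)) (e i)"
        by (simp only: t complex_cnj_complex_of_real scaleR_conv_of_real)
    qed
    finally show ?thesis .
  qed
  moreover have "l \<le> k"
    using e(1) card_image_le[of "{..<k}" w] by simp
  ultimately show thesis
    using that e(2) by blast
qed

section \<open>Riesz representation and weak limits along filters\<close>

text \<open>Variational argument: \<open>J\<close> is bounded below, the parallelogram law makes a
  minimising sequence Cauchy, and the minimiser given by completeness represents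
  \<open>f\<close>.\<close>

lemma real_riesz_representation:
  fixes f :: "'a::{real_inner, complete_space} \<Rightarrow> real"
  assumes "bounded_linear f"
  obtains w where "\<And>v. f v = inner v w"
proof -
  interpret bounded_linear f by fact
  obtain C where C: "\<And>x. \<bar>f x\<bar> \<le> norm x * C"
    using bounded by auto
  define J where "J v = (norm v)\<^sup>2 - 2 * f v" for v
  have J_ge: "- C\<^sup>2 \<le> J v" for v
  proof -
    have "0 \<le> (norm v - C)\<^sup>2"
      by simp
    then show ?thesis
      using C[of v] unfolding J_def power2_diff by linarith
  qed
  define m where "m = Inf (range J)"
  have bdd: "bdd_below (range J)"
    using J_ge by (auto intro!: bdd_belowI)
  have m_le: "m \<le> J v" for v
    unfolding m_def by (rule cInf_lower[OF _ bdd]) auto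
  have "\<exists>v. J v < m + inverse (real (Suc n))" for n
    using cInf_lessD[of "range J" "m + inverse (real (Suc n))"] by (auto simp: m_def)
  then obtain v where v: "\<And>n. J (v n) < m + inverse (real (Suc n))"
    by metis
  have par: "(norm (x - y))\<^sup>2 \<le> 2 * (J x - m) + 2 * (J y - m)" for x y
  proof -
    \<comment> \<open>The parallelogram law, with \<open>J\<close> at the midpoint bounded below by
      the infimum \<open>m\<close>.\<close>
    define h where "h = (1/2) *\<^sub>R (x + y)"
    have "J h = (norm (x + y))\<^sup>2 / 4 - (f x + f y)"
      by (simp add: J_def h_def scaleR add power_divide del: scaleR_add_right) (simp add: field_simps)
    then have "(norm (x - y))\<^sup>2 = 2 * J x + 2 * J y - 4 * J h"
      by (simp add: J_def) (simp add: power2_norm_eq_inner inner_simps inner_commute[of y x])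
    then show ?thesis
      using m_le[of h] by (simp add: algebra_simps)
  qed
  have "Cauchy v"
  proof (rule metric_CauchyI)
    fix e :: real assume "e > 0"
    then obtain N where N: "inverse (real (Suc N)) < e\<^sup>2 / 4"
      using reals_Archimedean[of "e\<^sup>2 / 4"] by auto
    have "dist (v i) (v j) < e" if "i \<ge> N" "j \<ge> N" for i j
    proof -
      have *: "J (v n) - m < e\<^sup>2 / 4" if "n \<ge> N" for n
      proof -
        have "inverse (real (Suc n)) \<le> inverse (real (Suc N))"
          using that by (intro le_imp_inverse_le) auto
        with N v[of n] show ?thesis
          by linarith
      qed
      have "(dist (v i) (v j))\<^sup>2 < e\<^sup>2"
        unfolding dist_norm using par[of "v i" "v j"] *[OF that(1)] *[OF that(2)] by argo
      then show ?thesis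
        using \<open>e > 0\<close> by (simp add: power_less_imp_less_base)
    qed
    then show "\<exists>N. \<forall>i\<ge>N. \<forall>j\<ge>N. dist (v i) (v j) < e"
      by blast
  qed
  then obtain w where w: "v \<longlonglongrightarrow> w"
    using Cauchy_convergent convergent_def by blast
  have "(\<lambda>n. J (v n)) \<longlonglongrightarrow> J w"
    unfolding J_def by (intro tendsto_intros tendsto w)
  moreover have "(\<lambda>n. m + inverse (real (Suc n))) \<longlonglongrightarrow> m + 0"
    by (intro tendsto_intros LIMSEQ_inverse_real_of_nat)
  ultimately have "J w \<le> m + 0"
    by (rule LIMSEQ_le) (use v less_imp_le in blast)
  then have Jw: "J w \<le> J x" for x
    using m_le[of x] by simp
  have "f h = inner h w" for h
  proof (rule ccontr)
    define a where "a = inner h w - f h"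
    \<comment> \<open>Moving from \<open>w\<close> by \<open>- (a / b) *\<^sub>R h\<close> lowers
      \<open>J\<close> by at least \<open>a\<^sup>2 / b\<close>; adding 1 makes \<open>b\<close>
      positive even for \<open>h = 0\<close>.\<close>
    define b where "b = (norm h)\<^sup>2 + 1"
    assume "f h \<noteq> inner h w"
    then have "a \<noteq> 0"
      by (simp add: a_def)
    have "b > 0"
      by (auto simp: b_def intro: add_nonneg_pos)
    have J_diff: "J (w - q *\<^sub>R h) - J w = q\<^sup>2 * (norm h)\<^sup>2 - 2 * q * a" for q
      by (simp add: J_def a_def power2_norm_eq_inner inner_simps diff scaleR inner_commute[of w h])
         (simp add: algebra_simps power2_eq_square)
    have "0 \<le> J (w - (a / b) *\<^sub>R h) - J w"
      using Jw by simp
    also have "\<dots> = (a / b)\<^sup>2 * (norm h)\<^sup>2 - 2 * (a / b) * a"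
      by (rule J_diff)
    also have "\<dots> \<le> (a / b)\<^sup>2 * b - 2 * (a / b) * a"
      by (intro diff_right_mono mult_left_mono) (auto simp: b_def)
    also have "\<dots> = - (a\<^sup>2 / b)"
      using \<open>b > 0\<close> by (simp add: field_simps power2_eq_square)
    also have "\<dots> < 0"
      using \<open>a \<noteq> 0\<close> \<open>b > 0\<close> by simp
    finally show False
      by simp
  qed
  then show thesis
    using that by blast
qed

text \<open>The real representation of the real part suffices: the imaginary part of
  \<open>f v\<close> is minus the real part of \<open>f (\<i> *\<^sub>C v)\<close>.\<close>

lemma riesz_representation:
  fixes f :: "'a::chilbert_space \<Rightarrow> complex"
  assumes f: "bounded_linear f" "\<And>c x. f (c *\<^sub>C x) = c * f x"
  obtains w where "\<And>v. f v = cinner v w"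
proof -
  have "bounded_linear (\<lambda>v. Re (f v))"
    by (rule bounded_linear_compose[OF bounded_linear_Re f(1)])
  then obtain w where w: "\<And>v. Re (f v) = inner v w"
    using real_riesz_representation by metis
  have "f v = cinner v w" for v
  proof (rule complex_eqI)
    show "Re (f v) = Re (cinner v w)"
      by (simp add: w inner_eq_Re_cinner)
    show "Im (f v) = Im (cinner v w)"
      using w[of "\<i> *\<^sub>C v"] by (simp add: f(2) inner_eq_Re_cinner cinner_simps)
  qed
  then show thesis
    using that by blast
qed

text \<open>Tychonoff's theorem gives a cluster point of the joint map into the product of the
  \<open>K i\<close>. Refining a filter takes the place of passing to a subsequence, since the index
  set may be uncountable.\<close>

lemma subfilter_tendsto:
  fixes g :: "'i \<Rightarrow> 'x \<Rightarrow> 'b::topological_space"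
  assumes F: "F \<noteq> bot" and K: "\<And>i. compact (K i)" and g: "\<forall>\<^sub>F x in F. \<forall>i. g i x \<in> K i"
  obtains F' L where "F' \<le> F" "F' \<noteq> bot" "\<And>i. (g i \<longlongrightarrow> L i) F'"
proof -
  define h where "h x = (\<lambda>i. g i x)" for x
  have "compact (PiE UNIV K)"
    using compactin_PiE[of "\<lambda>_. euclidean" UNIV K] K
    by (simp add: euclidean_product_topology compactin_euclidean_iff)
  moreover have "\<forall>\<^sub>F y in filtermap h F. y \<in> PiE UNIV K"
    using g by (simp add: eventually_filtermap h_def PiE_def Pi_def)
  moreover have "filtermap h F \<noteq> bot"
    using F by (simp add: filtermap_bot_iff)
  ultimately obtain L where L: "inf (nhds L) (filtermap h F) \<noteq> bot"
    unfolding compact_filter by meson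
  \<comment> \<open>Adding the preimages of the neighbourhoods of \<open>L\<close> forces
    convergence to \<open>L\<close>; the filter stays proper because \<open>L\<close> is a cluster
    point.\<close>
  define F' where "F' = inf F (filtercomap h (nhds L))"
  have "F' \<noteq> bot"
  proof
    assume "F' = bot"
    then have "eventually (\<lambda>_. False) F'"
      by simp
    then obtain P Q where P: "eventually P F" and Q: "eventually Q (nhds L)"
      and PQ: "\<And>x. P x \<Longrightarrow> \<not> Q (h x)"
      unfolding F'_def eventually_inf eventually_filtercomap by blast
    have "eventually (\<lambda>y. \<not> Q y) (filtermap h F)"
      unfolding eventually_filtermap using P by eventually_elim (rule PQ)
    with Q have "eventually (\<lambda>_. False) (inf (nhds L) (filtermap h F))"
      unfolding eventually_inf by blast
    then show False
      using L trivial_limit_def by blast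
  qed
  moreover have "filterlim h (nhds L) F'"
    unfolding F'_def by (meson filterlim_filtercomap filterlim_mono inf_le2 order_refl)
  then have "((\<lambda>x. h x i) \<longlongrightarrow> L i) F'" for i
  proof (intro topological_tendstoI)
    fix U assume "open U" "L i \<in> U"
    moreover from this have "open ((\<lambda>y. y i) -` U)"
      by (intro open_vimage continuous_on_product_coordinates)
    ultimately show "\<forall>\<^sub>F x in F'. h x i \<in> U"
      using topological_tendstoD[of h L F' "(\<lambda>y. y i) -` U"] \<open>filterlim h (nhds L) F'\<close> by simp
  qed
  ultimately show thesis
    using that[of F' L] by (simp add: F'_def h_def)
qed

text \<open>Weak compactness of balls, for all indices \<open>i\<close> at once: the pairings
  converge along one subfilter, their limit is a bounded linear functional of \<open>v\<close>, and
  Riesz representation turns it into a vector.\<close>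

lemma weakly_convergent_subfilter:
  fixes x :: "'x \<Rightarrow> 'i \<Rightarrow> 'a::chilbert_space"
  assumes F: "F \<noteq> bot" and x: "\<forall>\<^sub>F n in F. \<forall>i. norm (x n i) \<le> R"
  obtains F' w where "F' \<le> F" "F' \<noteq> bot"
    "\<And>i v. ((\<lambda>n. cinner v (x n i)) \<longlongrightarrow> cinner v (w i)) F'"
proof -
  define g where "g = (\<lambda>(i, v) n. cinner v (x n i))"
  have "\<forall>\<^sub>F n in F. \<forall>p. g p n \<in> cball 0 (norm (snd p) * R)"
    using x
  proof eventually_elim
    case (elim n)
    have "norm (cinner v (x n i)) \<le> norm v * R" for v i
      using norm_cinner_le[of v "x n i"] elim by (meson mult_left_mono norm_ge_zero order_trans)
    then show ?case
      by (auto simp: g_def)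
  qed
  from subfilter_tendsto[OF F compact_cball this]
  obtain F' L where F': "F' \<le> F" "F' \<noteq> bot" and L: "\<And>p. (g p \<longlongrightarrow> L p) F'"
    by metis
  have lim: "((\<lambda>n. cinner v (x n i)) \<longlongrightarrow> L (i, v)) F'" for i v
    using L[of "(i, v)"] by (simp add: g_def)
  have ev: "\<forall>\<^sub>F n in F'. norm (cinner v (x n i)) \<le> norm v * R" for v i
    using filter_leD[OF F'(1) x]
    by eventually_elim
      (use norm_cinner_le[of v] in \<open>meson mult_left_mono norm_ge_zero order_trans\<close>)
  have "\<exists>w. \<forall>v. L (i, v) = cinner v w" for i
  proof -
    have scale: "L (i, c *\<^sub>C v) = c * L (i, v)" for c v
      by (rule tendsto_unique[OF F'(2) lim]) (simp add: cinner_simps tendsto_mult_left lim)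
    have "bounded_linear (\<lambda>v. L (i, v))"
    proof (rule bounded_linear_intro)
      show "L (i, u + v) = L (i, u) + L (i, v)" for u v
        by (rule tendsto_unique[OF F'(2) lim]) (simp add: cinner_simps tendsto_add lim)
      show "L (i, r *\<^sub>R v) = r *\<^sub>R L (i, v)" for r v
        using scale[of "complex_of_real r" v] by (metis scaleR_conv_of_real scaleR_scaleC)
      show "norm (L (i, v)) \<le> norm v * R" for v
        by (rule tendsto_upperbound[OF tendsto_norm[OF lim] ev F'(2)])
    qed
    then show ?thesis
      using riesz_representation[of "\<lambda>v. L (i, v)"] scale by metis
  qed
  then obtain w where "\<And>i v. L (i, v) = cinner v (w i)"
    by metis
  then show thesis
    using that[OF F'] lim by metis
qed

section \<open>Compact operators and the essential numerical range\<close>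

lemma compact_operatorI:
  assumes "bounded_clinear T" "T ` cball 0 1 \<subseteq> C" "compact C"
  shows "compact_operator T"
proof -
  have "closure (T ` cball 0 1) \<subseteq> C"
    using assms by (simp add: closure_minimal compact_imp_closed)
  then have "closure (T ` cball 0 1) = C \<inter> closure (T ` cball 0 1)"
    by blast
  then show ?thesis
    unfolding compact_operator_def
    by (metis assms(1,3) closed_closure compact_Int_closed)
qed

text \<open>The functional is treated as an operator into \<open>complex\<close>, itself a complex
  inner product space, and maps the unit ball into a disc; the image thus lies in a compact disc of
  multiples of \<open>b\<close>.\<close>

lemma compact_operator_rank1:
  fixes \<phi> :: "'a::complex_inner \<Rightarrow> complex" and b :: "'b::complex_inner"
  assumes "bounded_clinear \<phi>"
  shows "compact_operator (\<lambda>v. \<phi> v *\<^sub>C b)"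
proof -
  have lin: "bounded_linear \<phi>"
    using assms by (rule bounded_clinearD)
  obtain M where M: "M \<ge> 0" "\<And>v. norm (\<phi> v) \<le> norm v * M"
    using bounded_linear.nonneg_bounded[OF lin] by blast
  show ?thesis
  proof (rule compact_operatorI)
    show "bounded_clinear (\<lambda>v. \<phi> v *\<^sub>C b)"
      using bounded_clinearD(2)[OF assms] lin unfolding bounded_clinear_def
      by (auto simp: scaleC_complex_def
          intro: bounded_linear_compose[OF bounded_bilinear_scaleC.bounded_linear_left])
    show "(\<lambda>v. \<phi> v *\<^sub>C b) ` cball 0 1 \<subseteq> (\<lambda>c. c *\<^sub>C b) ` cball 0 M"
    proof (safe intro!: imageI)
      fix v :: 'a assume "v \<in> cball 0 1"
      then have "norm v * M \<le> 1 * M"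
        using M(1) by (intro mult_right_mono) auto
      then show "\<phi> v \<in> cball 0 M"
        using M(2)[of v] by simp
    qed
    show "compact ((\<lambda>c. c *\<^sub>C b) ` cball 0 M)"
      by (intro compact_continuous_image compact_cball continuous_intros
          bounded_linear.continuous_on[OF bounded_bilinear_scaleC.bounded_linear_left])
  qed
qed

lemma compact_operator_add:
  assumes "compact_operator S" "compact_operator T"
  shows "compact_operator (\<lambda>v. S v + T v)"
proof (rule compact_operatorI)
  show "bounded_clinear (\<lambda>v. S v + T v)"
    using assms unfolding compact_operator_def bounded_clinear_def
    by (auto intro: bounded_linear_add simp: scaleC_add_right)
  show "compact {x + y | x y. x \<in> closure (S ` cball 0 1) \<and> y \<in> closure (T ` cball 0 1)}"
    using assms unfolding compact_operator_def by (intro compact_sums) auto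
  show "(\<lambda>v. S v + T v) ` cball 0 1
      \<subseteq> {x + y | x y. x \<in> closure (S ` cball 0 1) \<and> y \<in> closure (T ` cball 0 1)}"
    using closure_subset by blast
qed

lemma compact_operator_sum:
  assumes "\<And>i. i < (k::nat) \<Longrightarrow> compact_operator (T i)"
  shows "compact_operator (\<lambda>v. \<Sum>i<k. T i v)"
  using assms
proof (induction k)
  case 0
  show ?case
    by (rule compact_operatorI[of _ "{0}"]) (auto simp: bounded_clinear_def)
next
  case (Suc k)
  then show ?case
    by (simp add: compact_operator_add)
qed

text \<open>The image of the unit ball is covered by finitely many small balls. Weak convergence
  controls the pairings with their finitely many centres simultaneously, and the radius controls the
  rest.\<close>

lemma compact_operator_weakly_null:
  fixes r :: "'x \<Rightarrow> 'a::complex_inner"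
  assumes K: "compact_operator K"
    and weak: "\<And>v. ((\<lambda>x. cinner v (r x)) \<longlongrightarrow> 0) F"
    and R: "R > 0" "\<forall>\<^sub>F x in F. norm (r x) \<le> R"
  shows "((\<lambda>x. cinner (K (r x)) (r x)) \<longlongrightarrow> 0) F"
proof (rule tendstoI)
  fix \<epsilon> :: real assume "\<epsilon> > 0"
  \<comment> \<open>Solves \<open>R * (\<delta> * R + \<delta>) = \<epsilon>\<close>, the bound
    reached at the end.\<close>
  define \<delta> where "\<delta> = \<epsilon> / (R * (R + 1))"
  have "\<delta> > 0"
    using \<open>\<epsilon> > 0\<close> R by (simp add: \<delta>_def)
  have lin: "bounded_clinear K"
    using K by (simp add: compact_operator_def)
  obtain N where N: "finite N" "closure (K ` cball 0 1) \<subseteq> (\<Union>v\<in>N. ball v \<delta>)"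
    using K \<open>\<delta> > 0\<close> unfolding compact_operator_def compact_eq_totally_bounded by blast
  have "\<forall>\<^sub>F x in F. \<forall>v\<in>N. norm (cinner v (r x)) < \<delta>"
    using weak \<open>\<delta> > 0\<close> N(1)
    by (intro eventually_ball_finite) (auto simp: tendsto_iff dist_norm)
  with R(2) show "\<forall>\<^sub>F x in F. dist (cinner (K (r x)) (r x)) 0 < \<epsilon>"
  proof eventually_elim
    case (elim x)
    define c where "c = K ((1 / R) *\<^sub>R r x)"
    have "(1 / R) *\<^sub>R r x \<in> cball 0 1"
      using elim(1) R(1) by simp
    then have "c \<in> closure (K ` cball 0 1)"
      unfolding c_def by (intro subsetD[OF closure_subset] imageI)
    then obtain v where v: "v \<in> N" "norm (c - v) < \<delta>"
      using N(2) by (force simp: dist_norm norm_minus_commute)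
    have Kr: "K (r x) = R *\<^sub>R c"
      using R(1) by (simp add: c_def bounded_clinear_simps[OF lin])
    have "norm (cinner c (r x)) \<le> norm (cinner (c - v) (r x)) + norm (cinner v (r x))"
      using norm_triangle_ineq[of "cinner (c - v) (r x)" "cinner v (r x)"]
      by (simp add: cinner_simps)
    also have "\<dots> < \<delta> * R + \<delta>"
    proof (rule add_le_less_mono)
      show "norm (cinner (c - v) (r x)) \<le> \<delta> * R"
        using elim(1) v(2) \<open>\<delta> > 0\<close>
        by (intro order_trans[OF norm_cinner_le mult_mono]) auto
    qed (use elim(2) v(1) in blast)
    finally have "R * norm (cinner c (r x)) < R * (\<delta> * R + \<delta>)"
      using R(1) by simp
    also have "\<dots> = \<delta> * (R * (R + 1))"
      by (simp add: algebra_simps)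
    also have "\<dots> = \<epsilon>"
      using R(1) by (simp add: \<delta>_def)
    finally show ?case
      using R(1) by (simp add: Kr cinner_simps)
  qed
qed

lemma orthonormal_family_1: "orthonormal_family 1 x \<longleftrightarrow> norm (x 0) = 1"
  by (simp add: orthonormal_family_def cinner_self_eq_1_iff)

lemma joint_num_range_1:
  "joint_num_range 1 B = {(\<chi> j. cinner (B j u) u) | u. norm u = 1}"
  unfolding joint_num_range_def orthonormal_family_1 by auto

text \<open>The terms from compact operators vanish along the weakly null \<open>r\<close>, so after
  division by the squared norms the perturbed values at unit vectors still tend to \<open>s\<close>.
  The factor \<open>\<rho>\<close> admits remainders of any positive limiting size.\<close>

lemma joint_ess_num_rangeI:
  fixes r :: "'x \<Rightarrow> 'a::complex_inner" and A :: "'m::finite \<Rightarrow> 'a \<Rightarrow> 'a"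
  assumes F: "F \<noteq> bot" and A: "\<And>j. bounded_clinear (A j)"
    and weak: "\<And>v. ((\<lambda>x. cinner v (r x)) \<longlongrightarrow> 0) F"
    and nrm: "((\<lambda>x. (norm (r x))\<^sup>2) \<longlongrightarrow> \<rho>) F" "\<rho> > 0"
    and lim: "\<And>j. ((\<lambda>x. cinner (A j (r x)) (r x)) \<longlongrightarrow> \<rho> *\<^sub>R s $ j) F"
  shows "s \<in> joint_ess_num_range A"
  unfolding joint_ess_num_range_def
proof (intro INT_I, safe)
  fix K :: "'m \<Rightarrow> 'a \<Rightarrow> 'a" assume K: "\<forall>j. compact_operator (K j)"
  then have Klin: "bounded_clinear (K j)" for j
    by (simp add: compact_operator_def)
  have pos: "\<forall>\<^sub>F x in F. 0 < (norm (r x))\<^sup>2"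
    by (rule order_tendstoD(1)[OF nrm])
  have "\<forall>\<^sub>F x in F. (norm (r x))\<^sup>2 < \<rho> + 1"
    by (rule order_tendstoD(2)[OF nrm(1)]) simp
  then have bound: "\<forall>\<^sub>F x in F. norm (r x) \<le> sqrt (\<rho> + 1)"
    by eventually_elim (simp add: real_le_rsqrt)
  define u where "u x = (1 / norm (r x)) *\<^sub>R r x" for x
  define y where "y x = (\<chi> j. cinner (A j (u x) + K j (u x)) (u x))" for x
  have "\<forall>\<^sub>F x in F. y x \<in> closure (joint_num_range 1 (\<lambda>j x. A j x + K j x))"
    using pos
  proof eventually_elim
    case (elim x)
    then have "norm (u x) = 1"
      by (auto simp: u_def)
    then show ?case
      unfolding joint_num_range_1 y_def by (intro subsetD[OF closure_subset]) blast
  qed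
  moreover have "(y \<longlongrightarrow> s) F"
  proof (rule vec_tendstoI)
    fix j
    have "((\<lambda>x. (1 / (norm (r x))\<^sup>2) *\<^sub>R
        (cinner (A j (r x)) (r x) + cinner (K j (r x)) (r x))) \<longlongrightarrow> (1 / \<rho>) *\<^sub>R (\<rho> *\<^sub>R s $ j + 0)) F"
      using nrm(2) K
      by (intro tendsto_intros nrm(1) lim compact_operator_weakly_null[OF _ weak _ bound]) auto
    moreover have "y x $ j = (1 / (norm (r x))\<^sup>2) *\<^sub>R
        (cinner (A j (r x)) (r x) + cinner (K j (r x)) (r x))" for x
      by (simp add: y_def u_def bounded_clinear_simps[OF A] bounded_clinear_simps[OF Klin]
          cinner_simps power2_eq_square scaleR_add_right)
    ultimately show "((\<lambda>x. y x $ j) \<longlongrightarrow> s $ j) F"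
      using nrm(2) by simp
  qed
  ultimately show "s \<in> closure (joint_num_range 1 (\<lambda>j x. A j x + K j x))"
    using Lim_in_closed_set[OF closed_closure _ F] by blast
qed

lemma bounded_clinear_quadratic_form_bound:
  fixes A :: "'m \<Rightarrow> 'a::complex_inner \<Rightarrow> 'a"
  assumes "\<And>j. bounded_clinear (A j)"
  obtains M where "\<And>j. M j \<ge> 0" "\<And>j v. norm (cinner (A j v) v) \<le> M j * (norm v)\<^sup>2"
proof -
  have "\<exists>M\<ge>0. \<forall>v. norm (A j v) \<le> norm v * M" for j
    using bounded_linear.nonneg_bounded[OF bounded_clinearD(1)[OF assms]] by blast
  then obtain M where M: "\<And>j. M j \<ge> 0" "\<And>j v. norm (A j v) \<le> norm v * M j"
    by metis
  have "norm (cinner (A j v) v) \<le> M j * (norm v)\<^sup>2" for j v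
  proof -
    have "norm (cinner (A j v) v) \<le> norm (A j v) * norm v"
      by (rule norm_cinner_le)
    also have "\<dots> \<le> (norm v * M j) * norm v"
      by (intro mult_right_mono M) simp
    finally show ?thesis
      by (simp add: power2_eq_square ac_simps)
  qed
  then show thesis
    using that M(1) by blast
qed

text \<open>The sets of unit vectors orthogonal to finitely many given vectors generate a proper
  filter along which the identity is weakly null; a limit of the values of \<open>A\<close> along a
  subfilter lies in the essential range.\<close>

lemma joint_ess_num_range_nonempty:
  fixes A :: "'m::finite \<Rightarrow> 'a::complex_inner \<Rightarrow> 'a"
  assumes "\<not> cfinite_dim TYPE('a)" "\<And>j. bounded_clinear (A j)"
  shows "joint_ess_num_range A \<noteq> {}"
proof -
  define U where "U v = {y :: 'a. norm y = 1 \<and> cinner v y = 0}" for v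
  define F where "F = (INF v. principal (U v))"
  have "F \<noteq> bot"
    unfolding F_def
  proof (rule INF_filter_not_bot)
    fix X :: "'a set" assume "finite X"
    then obtain u where "norm u = 1" "\<And>v. v \<in> X \<Longrightarrow> cinner u v = 0"
      using exists_unit_orthogonal[OF assms(1)] by metis
    then have "u \<in> (\<Inter>v\<in>X. U v)"
      using cinner_eq_0_commute by (auto simp: U_def)
    then show "(INF v\<in>X. principal (U v)) \<noteq> bot"
      using \<open>finite X\<close> by (subst INF_principal_finite) (auto simp: principal_eq_bot_iff)
  qed
  have ev: "\<forall>\<^sub>F y in F. y \<in> U v" for v
    unfolding F_def by (rule eventually_INF1[of v]) (auto simp: eventually_principal)
  obtain M where M: "\<And>j v. norm (cinner (A j v) v) \<le> M j * (norm v)\<^sup>2"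
    using bounded_clinear_quadratic_form_bound[of A, OF assms(2)] by metis
  have "\<forall>\<^sub>F y in F. \<forall>j. cinner (A j y) y \<in> cball 0 (M j)"
    \<comment> \<open>Orthogonality to 0 is vacuous, so this instance says only that
      \<open>y\<close> is a unit vector.\<close>
    using ev[of 0]
  proof eventually_elim
    case (elim y)
    then show ?case
      using M[of _ y] by (auto simp: U_def)
  qed
  from subfilter_tendsto[OF \<open>F \<noteq> bot\<close> compact_cball this]
  obtain F' L where F': "F' \<le> F" "F' \<noteq> bot"
    and L: "\<And>j. ((\<lambda>y. cinner (A j y) y) \<longlongrightarrow> L j) F'"
    by metis
  have ev': "\<forall>\<^sub>F y in F'. y \<in> U v" for v
    by (rule filter_leD[OF F'(1) ev])
  have "(\<chi> j. L j) \<in> joint_ess_num_range A"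
  proof (rule joint_ess_num_rangeI[OF F'(2) assms(2)])
    show "((\<lambda>y. cinner v y) \<longlongrightarrow> 0) F'" for v
      using ev'[of v] by (intro tendsto_eventually) (auto simp: U_def elim: eventually_mono)
    show "((\<lambda>y. (norm y)\<^sup>2) \<longlongrightarrow> 1) F'"
      using ev'[of 0] by (intro tendsto_eventually) (auto simp: U_def elim: eventually_mono)
  qed (simp_all add: L)
  then show ?thesis
    by blast
qed

section \<open>Points of the essential numerical range inside the closed convex hull\<close>

text \<open>Compressing to the orthogonal complement of \<open>x\<^sub>0, \<dots>, x\<^sub>l\<^sub>-\<^sub>1\<close> and putting a value of that
  compression on their span is a finite-rank perturbation of \<open>A\<close>.\<close>

lemma joint_ess_num_range_subset_orthogonal:
  fixes A :: "'m::finite \<Rightarrow> 'a::complex_inner \<Rightarrow> 'a"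
  assumes dim: "\<not> cfinite_dim TYPE('a)" and A: "\<And>j. bounded_clinear (A j)"
    and x: "orthonormal_family l x"
  shows "joint_ess_num_range A \<subseteq> closure (convex hull
    {(\<chi> j. cinner (A j u) u) | u. norm u = 1 \<and> (\<forall>i<l. cinner u (x i) = 0)})"
    (is "_ \<subseteq> closure (convex hull ?V)")
proof -
  define val where "val u = (\<chi> j. cinner (A j u) u)" for u
  obtain u0 where u0: "norm u0 = 1" "\<And>i. i < l \<Longrightarrow> cinner u0 (x i) = 0"
    by (rule exists_unit_orthogonal[OF dim, of "x ` {..<l}"]) auto
  define c where "c j = cinner (A j u0) u0" for j
  define P where "P = orthoproj l x"
  define Q where "Q v = v - P v" for v
  \<comment> \<open>Chosen so that \<open>A j + K j\<close> becomes \<open>Q\<close> after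
    \<open>A j\<close> after \<open>Q\<close>, plus \<open>c j\<close> times \<open>P\<close>, where
    \<open>c\<close> is the value of \<open>A\<close> at the unit vector \<open>u0\<close>
    orthogonal to the family.\<close>
  define K where "K j v = (\<Sum>i<l. cinner v (x i) *\<^sub>C (c j *\<^sub>C x i - A j (x i))) +
    (\<Sum>i<l. (- cinner (A j (Q v)) (x i)) *\<^sub>C x i)" for j v
  have Qx: "cinner (Q v) (x i) = 0" if "i < l" for v i
    by (simp add: Q_def P_def cinner_residual[OF x that])
  have QP: "cinner (Q v) (P y) = 0" for v y
    unfolding P_def by (rule cinner_orthoproj_orthogonal) (rule Qx)
  have PQ: "cinner (P v) (Q y) = 0" for v y
    using QP cinner_eq_0_commute by blast
  have "P = (\<lambda>v. \<Sum>i<l. cinner v (x i) *\<^sub>C x i)"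
    by (rule ext) (simp add: P_def orthoproj_def)
  then have P: "bounded_clinear P"
    by (simp add: bounded_clinear_sum bounded_clinear_rank1)
  have "compact_operator (K j)" for j
  proof -
    have "bounded_clinear (\<lambda>v. cinner v y)" for y :: 'a
      by (auto simp: bounded_clinear_def scaleC_complex_def cinner_simps
          bounded_bilinear_cinner.bounded_linear_left)
    moreover have "bounded_clinear (\<lambda>v. - cinner (A j (Q v)) y)" for y
      unfolding bounded_clinear_def Q_def
      using bounded_clinearD(2)[OF A] bounded_clinearD(2)[OF P]
      by (auto simp: scaleC_complex_def cinner_simps bounded_clinear_simps[OF A] algebra_simps
          intro!: bounded_linear_minus bounded_linear_compose[OF bounded_bilinear_cinner.bounded_linear_left]
            bounded_linear_sub bounded_linear_compose[OF bounded_clinearD(1)[OF A]]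
            bounded_clinearD(1)[OF P] bounded_linear_ident A)
    ultimately show ?thesis
      unfolding K_def
      by (intro compact_operator_add compact_operator_sum compact_operator_rank1)
  qed
  then have "joint_ess_num_range A \<subseteq> closure (joint_num_range 1 (\<lambda>j x. A j x + K j x))"
    unfolding joint_ess_num_range_def by blast
  also have "\<dots> \<subseteq> closure (convex hull ?V)"
  proof (rule closure_mono, rule subsetI)
    fix y assume "y \<in> joint_num_range 1 (\<lambda>j x. A j x + K j x)"
    then obtain v where v: "norm v = 1" "y = (\<chi> j. cinner (A j v + K j v) v)"
      unfolding joint_num_range_1 by blast
    have AK: "A j v + K j v = A j (Q v) - P (A j (Q v)) + c j *\<^sub>C P v" for j
    proof -
      have "K j v = c j *\<^sub>C P v - A j (P v) - P (A j (Q v))"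
        by (simp add: K_def P_def orthoproj_def complex_vector.scale_right_diff_distrib sum_subtractf
            bounded_clinear_simps[OF A] bounded_clinearD(2)[OF A] complex_vector.scale_sum_right
            sum_negf mult.commute)
      then show ?thesis
        by (simp add: Q_def bounded_clinear_simps[OF A])
    qed
    have QQ: "cinner (w - P w) v = cinner w (Q v)" for w
    proof -
      have "cinner (w - P w) v = cinner (Q w) (Q v) + cinner (Q w) (P v)"
        by (simp add: Q_def cinner_simps)
      also have "\<dots> = cinner (Q w) (Q v) + cinner (P w) (Q v)"
        by (simp add: QP PQ)
      finally show ?thesis
        by (simp add: Q_def cinner_simps)
    qed
    have PP: "cinner (P v) v = complex_of_real ((norm (P v))\<^sup>2)"
    proof -
      have "cinner (P v) v = cinner (P v) (Q v) + cinner (P v) (P v)"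
        by (simp add: Q_def cinner_simps)
      then show ?thesis
        by (simp add: PQ cinner_self)
    qed
    have y: "y $ j = cinner (A j (Q v)) (Q v) + (norm (P v))\<^sup>2 *\<^sub>R c j" for j
    proof -
      have "y $ j = cinner (A j (Q v) - P (A j (Q v))) v + c j * cinner (P v) v"
        by (simp only: v vec_lambda_beta AK cinner_add_left cinner_scaleC_left)
      then show ?thesis
        by (simp only: QQ PP scaleR_conv_of_real mult.commute)
    qed
    \<comment> \<open>These two weights express \<open>y\<close> as a convex combination of the
      value at the normalised \<open>Q v\<close> and the value \<open>c\<close>.\<close>
    have sum1: "(norm (Q v))\<^sup>2 + (norm (P v))\<^sup>2 = 1"
      using norm_add_sq_orthogonal[OF QP, of v v] v(1) by (simp add: Q_def)
    have c: "(\<chi> j. c j) \<in> ?V"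
      unfolding c_def using u0 by blast
    show "y \<in> convex hull ?V"
    proof (cases "Q v = 0")
      case True
      then have "y = (\<chi> j. c j)"
        using sum1 by (simp add: vec_eq_iff y cinner_simps bounded_clinear_simps[OF A])
      then show ?thesis
        using hull_inc[OF c] by simp
    next
      case False
      define u where "u = (1 / norm (Q v)) *\<^sub>R Q v"
      have "norm u = 1" "\<forall>i<l. cinner u (x i) = 0"
        using False Qx by (auto simp: u_def cinner_simps)
      then have "(\<chi> j. cinner (A j u) u) \<in> ?V"
        by blast
      then have "(norm (Q v))\<^sup>2 *\<^sub>R (\<chi> j. cinner (A j u) u) + (norm (P v))\<^sup>2 *\<^sub>R (\<chi> j. c j)
          \<in> convex hull ?V"
        using c sum1 by (intro convexD[OF convex_convex_hull] hull_inc) auto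
      also have "(norm (Q v))\<^sup>2 *\<^sub>R (\<chi> j. cinner (A j u) u) + (norm (P v))\<^sup>2 *\<^sub>R (\<chi> j. c j) = y"
        using False
        by (simp add: vec_eq_iff y u_def bounded_clinear_simps[OF A] cinner_simps power2_eq_square)
      finally show ?thesis .
    qed
  qed
  finally show ?thesis .
qed

text \<open>Induction on \<open>n\<close>: adjoining any unit vector \<open>u\<close> orthogonal to
  the family uses up one copy of \<open>s\<close>, and \<open>s\<close> lies in the closed convex
  hull of the values at such \<open>u\<close>.\<close>

lemma orthonormal_plus_ess_in_closure:
  fixes A :: "'m::finite \<Rightarrow> 'a::complex_inner \<Rightarrow> 'a"
  assumes dim: "\<not> cfinite_dim TYPE('a)" and A: "\<And>j. bounded_clinear (A j)"
    and s: "s \<in> joint_ess_num_range A" and x: "orthonormal_family l x"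
  shows "(\<chi> j. \<Sum>i<l. cinner (A j (x i)) (x i)) + real n *\<^sub>R s
    \<in> closure (convex hull (joint_num_range (l + n) A))"
  using x
proof (induction n arbitrary: l x)
  case 0
  then have "(\<chi> j. \<Sum>i<l. cinner (A j (x i)) (x i)) \<in> joint_num_range l A"
    by (auto simp: joint_num_range_def)
  then show ?case
    by (auto intro: subsetD[OF closure_subset] hull_inc)
next
  case (Suc n)
  let ?V = "{(\<chi> j. cinner (A j u) u) | u. norm u = 1 \<and> (\<forall>i<l. cinner u (x i) = 0)}"
  define C where "C = closure (convex hull (joint_num_range (Suc (l + n)) A))"
  define z where "z = (\<chi> j. \<Sum>i<l. cinner (A j (x i)) (x i)) + real n *\<^sub>R s"
  \<comment> \<open>The points \<open>y\<close> with \<open>z + y\<close> in \<open>C\<close>. This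
    set is closed and convex, so containing the values at all admissible \<open>u\<close> it also
    contains \<open>s\<close>.\<close>
  define D where "D = (\<lambda>y. - z + y) ` C"
  have D: "convex D" "closed D"
    unfolding D_def C_def
    by (intro convex_translation closed_translation convex_closure convex_convex_hull closed_closure)+
  have "?V \<subseteq> D"
  proof safe
    fix u assume u: "norm u = 1" "\<forall>i<l. cinner u (x i) = 0"
    have "orthonormal_family (Suc l) (x(l := u))"
      using orthonormal_family_Suc[OF Suc.prems] u by blast
    from Suc.IH[OF this] have "z + (\<chi> j. cinner (A j u) u) \<in> C"
      by (simp add: z_def C_def) (simp add: vec_eq_iff algebra_simps plus_vec_def)
    then show "(\<chi> j. cinner (A j u) u) \<in> D"
      by (force simp: D_def image_iff)
  qed
  then have "closure (convex hull ?V) \<subseteq> D"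
    by (intro closure_minimal hull_minimal D)
  then have "s \<in> D"
    using s joint_ess_num_range_subset_orthogonal[where A = A, OF dim A Suc.prems] by blast
  then have "z + s \<in> C"
    by (auto simp: D_def)
  then show ?case
    by (simp add: z_def C_def algebra_simps)
qed

section \<open>Limit points of the joint numerical range\<close>

lemma norm_diff_sq:
  fixes x w :: "'a::complex_inner"
  shows "(norm (x - w))\<^sup>2 = (norm x)\<^sup>2 - 2 * Re (cinner w x) + (norm w)\<^sup>2"
  unfolding inner_eq_Re_cinner[symmetric]
  by (simp add: power2_norm_eq_inner inner_diff_left inner_diff_right inner_commute[of x w])

lemma joint_num_rangeI:
  "orthonormal_family k x \<Longrightarrow> (\<chi> j. \<Sum>l<k. cinner (B j (x l)) (x l)) \<in> joint_num_range k B"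
  unfolding joint_num_range_def by (rule CollectI, rule exI[of _ x]) simp

lemma joint_num_rangeE:
  assumes "y \<in> joint_num_range k B"
  obtains x where "orthonormal_family k x" "y = (\<chi> j. \<Sum>l<k. cinner (B j (x l)) (x l))"
  using assms unfolding joint_num_range_def by blast

lemma bounded_joint_num_range:
  fixes A :: "'m::finite \<Rightarrow> 'a::complex_inner \<Rightarrow> 'a"
  assumes "\<And>j. bounded_clinear (A j)"
  shows "bounded (joint_num_range k A)"
proof -
  obtain M where M: "\<And>j v. norm (cinner (A j v) v) \<le> M j * (norm v)\<^sup>2"
    using bounded_clinear_quadratic_form_bound[of A, OF assms] by metis
  have "norm y \<le> (\<Sum>j\<in>UNIV. real k * M j)" if yW: "y \<in> joint_num_range k A" for y
  proof -
    obtain x where x: "orthonormal_family k x"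
      and y: "y = (\<chi> j. \<Sum>l<k. cinner (A j (x l)) (x l))"
      using yW by (rule joint_num_rangeE)
    have "norm y \<le> (\<Sum>j\<in>UNIV. norm (y $ j))"
      unfolding norm_vec_def by (rule L2_set_le_sum) simp
    also have "\<dots> \<le> (\<Sum>j\<in>UNIV. real k * M j)"
    proof (rule sum_mono)
      fix j
      have "norm (y $ j) \<le> (\<Sum>l<k. norm (cinner (A j (x l)) (x l)))"
        by (simp add: y norm_sum)
      also have "\<dots> \<le> (\<Sum>l<k. M j)"
        using M[of j] orthonormal_family_norm[OF x]
        by (intro sum_mono) (metis lessThan_iff mult.right_neutral one_power2)
      finally show "norm (y $ j) \<le> real k * M j"
        by simp
    qed
    finally show ?thesis .
  qed
  then show ?thesis
    by (rule boundedI)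
qed

text \<open>The point is affine in each \<open>t i\<close> separately, hence a convex combination of
  its values at the vertices of the cube, which are indexed by subsets \<open>I\<close>. The offset
  \<open>c\<close> absorbs the endpoints already chosen in the induction.\<close>

lemma convex_combination_of_vertices:
  fixes a b :: "'i \<Rightarrow> 'v::real_vector"
  assumes "finite D" "convex C" "\<And>i. i \<in> D \<Longrightarrow> 0 \<le> t i \<and> t i \<le> (1::real)"
    "\<And>I. I \<subseteq> D \<Longrightarrow> c + (\<Sum>i\<in>I. a i) + (\<Sum>i\<in>D - I. b i) \<in> C"
  shows "c + (\<Sum>i\<in>D. t i *\<^sub>R a i + (1 - t i) *\<^sub>R b i) \<in> C"
  using assms(1,3,4)
proof (induction D arbitrary: c)
  case empty
  then show ?case by auto
next
  case (insert x D)
  let ?S = "\<Sum>i\<in>D. t i *\<^sub>R a i + (1 - t i) *\<^sub>R b i"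
  have "(c + a x) + ?S \<in> C"
  proof (rule insert.IH)
    fix I assume "I \<subseteq> D"
    then have "finite I" "x \<notin> I" "insert x D - insert x I = D - I"
      using insert.hyps finite_subset by auto
    then show "c + a x + (\<Sum>i\<in>I. a i) + (\<Sum>i\<in>D - I. b i) \<in> C"
      using insert.prems(2)[of "insert x I"] \<open>I \<subseteq> D\<close> by (auto simp: add.assoc)
  qed (use insert.prems in auto)
  moreover have "(c + b x) + ?S \<in> C"
  proof (rule insert.IH)
    fix I assume "I \<subseteq> D"
    then have "insert x D - I = insert x (D - I)"
      using insert.hyps by auto
    then show "c + b x + (\<Sum>i\<in>I. a i) + (\<Sum>i\<in>D - I. b i) \<in> C"
      using insert.prems(2)[of I] \<open>I \<subseteq> D\<close> insert.hyps by (auto simp: add_ac)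
  qed (use insert.prems in auto)
  ultimately have "t x *\<^sub>R ((c + a x) + ?S) + (1 - t x) *\<^sub>R ((c + b x) + ?S) \<in> C"
    using insert.prems(1)[of x] by (intro convexD[OF assms(2)]) auto
  also have "t x *\<^sub>R ((c + a x) + ?S) + (1 - t x) *\<^sub>R ((c + b x) + ?S) =
      c + (t x *\<^sub>R a x + (1 - t x) *\<^sub>R b x + ?S)"
    by (simp add: algebra_simps)
  finally show ?case
    using insert.hyps by simp
qed

text \<open>Normalise the weights by their sum; if the sum is zero, all weights vanish and any point
  of \<open>S\<close> serves as \<open>p\<close>.\<close>

lemma weighted_sum_in_convex_hull:
  fixes s :: "'i \<Rightarrow> 'v::real_vector"
  assumes "finite D" "\<And>i. i \<in> D \<Longrightarrow> 0 \<le> \<rho> i" "\<And>i. i \<in> D \<Longrightarrow> s i \<in> S" "S \<noteq> {}"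
  obtains p where "p \<in> convex hull S" "(\<Sum>i\<in>D. \<rho> i *\<^sub>R s i) = (\<Sum>i\<in>D. \<rho> i) *\<^sub>R p"
proof (cases "(\<Sum>i\<in>D. \<rho> i) = 0")
  case True
  then have "\<forall>i\<in>D. \<rho> i = 0"
    using assms(1,2) by (simp add: sum_nonneg_eq_0_iff)
  moreover obtain p where "p \<in> S"
    using assms(4) by blast
  ultimately show thesis
    using that[of p] by (simp add: hull_inc)
next
  case False
  let ?R = "\<Sum>i\<in>D. \<rho> i"
  have "(\<Sum>i\<in>D. (\<rho> i / ?R) *\<^sub>R s i) \<in> convex hull S"
    using False assms
    by (intro convex_sum convex_convex_hull)
       (auto simp: hull_inc sum_divide_distrib[symmetric] intro!: divide_nonneg_nonneg sum_nonneg)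
  moreover have "(\<Sum>i\<in>D. \<rho> i *\<^sub>R s i) = ?R *\<^sub>R (\<Sum>i\<in>D. (\<rho> i / ?R) *\<^sub>R s i)"
    using False by (simp add: scaleR_sum_right)
  ultimately show thesis
    using that by blast
qed

lemma joint_num_range_subfamily:
  assumes e: "orthonormal_family l e" and I: "I \<subseteq> {..<l}"
  shows "(\<Sum>i\<in>I. \<chi> j. cinner (A j (e i)) (e i)) \<in> joint_num_range (card I) A"
proof -
  have "finite I"
    using I finite_subset by blast
  then obtain h where h: "bij_betw h {..<card I} I"
    using ex_bij_betw_nat_finite by (metis lessThan_atLeast0)
  have hI: "h i \<in> I" "h i < l" if "i < card I" for i
    using h I that by (auto simp: bij_betw_def)
  have sum_eq: "(\<Sum>i\<in>I. \<chi> j. cinner (A j (e i)) (e i)) =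
      (\<chi> j. \<Sum>i<card I. cinner (A j (e (h i))) (e (h i)))"
    unfolding vec_eq_iff sum_component vec_lambda_beta
    by (intro allI sum.reindex_bij_betw[OF h, symmetric])
  have "orthonormal_family (card I) (\<lambda>i. e (h i))"
    unfolding orthonormal_family_def
  proof (intro allI impI)
    fix i j assume ij: "i < card I" "j < card I"
    then have "h i = h j \<longleftrightarrow> i = j"
      using h by (auto simp: bij_betw_def inj_on_def)
    then show "cinner (e (h i)) (e (h j)) = (if i = j then 1 else 0)"
      using orthonormal_familyD[OF e hI(2)[OF ij(1)] hI(2)[OF ij(2)]] by simp
  qed
  from joint_num_rangeI[OF this, of A] show ?thesis
    by (simp only: sum_eq)
qed

text \<open>Each approximating vector is split into its weak limit \<open>w i\<close> and a weakly
  null remainder. The mixed terms of the quadratic forms converge, so the form splits asymptotically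
  into a part at \<open>w i\<close> and a part giving an essential value. The first inequality is
  Bessel's, passed to the limit.\<close>

lemma closure_joint_num_range_decomposition:
  fixes A :: "'m::finite \<Rightarrow> 'a::chilbert_space \<Rightarrow> 'a"
  assumes dim: "\<not> cfinite_dim TYPE('a)" and A: "\<And>j. bounded_clinear (A j)"
    and sa: "\<And>j. selfadjoint (A j)" and z: "z \<in> closure (joint_num_range k A)"
  obtains w s where
    "\<And>v. (\<Sum>i<k. (norm (cinner v (w i)))\<^sup>2) \<le> (norm v)\<^sup>2"
    "\<And>i. i < k \<Longrightarrow> norm (w i) \<le> 1"
    "\<And>i. i < k \<Longrightarrow> s i \<in> joint_ess_num_range A"
    "z = (\<Sum>i<k. (\<chi> j. cinner (A j (w i)) (w i)) + (1 - (norm (w i))\<^sup>2) *\<^sub>R s i)"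
proof -
  obtain y where y: "\<And>n. y n \<in> joint_num_range k A" "y \<longlonglongrightarrow> z"
    using z unfolding closure_sequential by blast
  then have "\<forall>n. \<exists>x. orthonormal_family k x \<and> y n = (\<chi> j. \<Sum>l<k. cinner (A j (x l)) (x l))"
    unfolding joint_num_range_def by blast
  from choice[OF this] obtain x where x: "\<And>n. orthonormal_family k (x n)"
    and yx: "\<And>n. y n = (\<chi> j. \<Sum>l<k. cinner (A j (x n l)) (x n l))"
    by blast
  \<comment> \<open>Padding by zero gives the norm bound for every index, as the weak compactness
    lemma demands.\<close>
  define X where "X n i = (if i < k then x n i else 0)" for n i
  have X1: "norm (X n i) = 1" if "i < k" for n i
    using that by (simp add: X_def orthonormal_family_norm[OF x])
  have Xle: "norm (X n i) \<le> 1" for n i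
    using X1[of i n] by (cases "i < k") (auto simp: X_def)
  have "\<forall>\<^sub>F n in sequentially. \<forall>i. norm (X n i) \<le> 1"
    using Xle by simp
  from weakly_convergent_subfilter[OF trivial_limit_sequentially this]
  obtain F1 w where F1: "F1 \<le> sequentially" "F1 \<noteq> bot"
    and w1: "\<And>i v. ((\<lambda>n. cinner v (X n i)) \<longlongrightarrow> cinner v (w i)) F1"
    by blast
  obtain M where M: "\<And>j. 0 \<le> M j" "\<And>j v. norm (cinner (A j v) v) \<le> M j * (norm v)\<^sup>2"
    using bounded_clinear_quadratic_form_bound[of A, OF A] by metis
  \<comment> \<open>A second refinement makes the quadratic forms converge too, since weak
    convergence alone does not.\<close>
  define g where "g = (\<lambda>(i, j) n. cinner (A j (X n i)) (X n i))"
  have g_bound: "g p n \<in> cball 0 (M (snd p))" for p n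
  proof -
    obtain i j where p: "p = (i, j)"
      by fastforce
    have "(norm (X n i))\<^sup>2 \<le> 1"
      using Xle[of n i] by (simp add: power_le_one)
    then have "norm (cinner (A j (X n i)) (X n i)) \<le> M j * 1"
      using M(2)[of j "X n i"] mult_left_mono[OF _ M(1), of _ 1 j] order_trans by blast
    then show ?thesis
      by (simp add: g_def p)
  qed
  have "\<forall>\<^sub>F n in F1. \<forall>p. g p n \<in> cball 0 (M (snd p))"
    using g_bound by simp
  from subfilter_tendsto[OF F1(2) compact_cball this]
  obtain F L where F: "F \<le> F1" "F \<noteq> bot" and gL: "\<And>p. (g p \<longlongrightarrow> L p) F"
    by metis
  define c where "c i j = L (i, j)" for i j
  have c: "((\<lambda>n. cinner (A j (X n i)) (X n i)) \<longlongrightarrow> c i j) F" for i j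
    using gL[of "(i, j)"] by (simp add: g_def c_def)
  have w: "((\<lambda>n. cinner v (X n i)) \<longlongrightarrow> cinner v (w i)) F" for i v
    by (rule tendsto_mono[OF F(1) w1])
  have w': "((\<lambda>n. cinner (X n i) v) \<longlongrightarrow> cinner (w i) v) F" for i v
    using tendsto_cnj[OF w[of v i]] by (simp flip: cinner_commute)
  have zc: "z $ j = (\<Sum>i<k. c i j)" for j
  proof (rule tendsto_unique[OF F(2)])
    have "(y \<longlongrightarrow> z) F"
      using tendsto_mono[OF order_trans[OF F(1) F1(1)] y(2)] .
    then show "((\<lambda>n. y n $ j) \<longlongrightarrow> z $ j) F"
      by (rule tendsto_vec_nth)
    have "y n $ j = (\<Sum>i<k. cinner (A j (X n i)) (X n i))" for n
      by (simp add: yx X_def)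
    then show "((\<lambda>n. y n $ j) \<longlongrightarrow> (\<Sum>i<k. c i j)) F"
      by (simp add: tendsto_sum c)
  qed
  define r where "r i n = X n i - w i" for i n
  have r_weak: "((\<lambda>n. cinner v (r i n)) \<longlongrightarrow> 0) F" for i v
    using tendsto_diff[OF w[of v i] tendsto_const[of "cinner v (w i)"]]
    by (simp add: r_def cinner_simps)
  have r_norm: "((\<lambda>n. (norm (r i n))\<^sup>2) \<longlongrightarrow> 1 - (norm (w i))\<^sup>2) F" if "i < k" for i
  proof -
    have "(norm (r i n))\<^sup>2 = 1 - 2 * Re (cinner (w i) (X n i)) + (norm (w i))\<^sup>2" for n
      by (simp add: r_def norm_diff_sq X1[OF that])
    moreover have "((\<lambda>n. 1 - 2 * Re (cinner (w i) (X n i)) + (norm (w i))\<^sup>2)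
        \<longlongrightarrow> 1 - 2 * Re (cinner (w i) (w i)) + (norm (w i))\<^sup>2) F"
      by (intro tendsto_intros w)
    ultimately show ?thesis
      by (simp add: cinner_self)
  qed
  have \<rho>_nonneg: "0 \<le> 1 - (norm (w i))\<^sup>2" if "i < k" for i
    by (rule tendsto_lowerbound[OF r_norm[OF that] _ F(2)]) simp
  \<comment> \<open>Self-adjointness moves \<open>A j\<close> onto the fixed vector
    \<open>w i\<close> in the mixed term, where weak convergence applies.\<close>
  have r_lim: "((\<lambda>n. cinner (A j (r i n)) (r i n)) \<longlongrightarrow> c i j - cinner (A j (w i)) (w i)) F" for i j
  proof -
    have "cinner (A j (r i n)) (r i n) = cinner (A j (X n i)) (X n i) - cinner (X n i) (A j (w i))
        - cinner (A j (w i)) (X n i) + cinner (A j (w i)) (w i)" for n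
      using sa[of j]
      by (simp add: r_def bounded_clinear_simps[OF A] cinner_simps selfadjoint_def)
    moreover have "((\<lambda>n. cinner (A j (X n i)) (X n i) - cinner (X n i) (A j (w i))
        - cinner (A j (w i)) (X n i) + cinner (A j (w i)) (w i))
        \<longlongrightarrow> c i j - cinner (w i) (A j (w i)) - cinner (A j (w i)) (w i) + cinner (A j (w i)) (w i)) F"
      by (intro tendsto_intros w w' c)
    moreover have "cinner (w i) (A j (w i)) = cinner (A j (w i)) (w i)"
      using sa[of j] by (simp add: selfadjoint_def)
    ultimately show ?thesis
      by simp
  qed
  have "\<exists>s\<in>joint_ess_num_range A. \<forall>j. c i j - cinner (A j (w i)) (w i) = (1 - (norm (w i))\<^sup>2) *\<^sub>R s $ j"
    if i: "i < k" for i
  proof (cases "1 - (norm (w i))\<^sup>2 = 0")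
    \<comment> \<open>Here the remainders tend to 0 in norm, so the essential term has weight 0 and
      any point of the nonempty essential range will do.\<close>
    case True
    have "c i j - cinner (A j (w i)) (w i) = 0" for j
    proof (rule tendsto_unique[OF F(2) r_lim])
      have "((\<lambda>n. M j * (norm (r i n))\<^sup>2) \<longlongrightarrow> 0) F"
        using tendsto_mult_left[OF r_norm[OF i], of "M j"] True by simp
      then show "((\<lambda>n. cinner (A j (r i n)) (r i n)) \<longlongrightarrow> 0) F"
        by (rule Lim_null_comparison[rotated]) (use M(2) in simp)
    qed
    moreover obtain s where "s \<in> joint_ess_num_range A"
      using joint_ess_num_range_nonempty[OF dim, of A] A by blast
    ultimately show ?thesis
      using True by auto
  next
    case False
    define \<rho> where "\<rho> = 1 - (norm (w i))\<^sup>2"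
    have "\<rho> > 0"
      using False \<rho>_nonneg[OF i] by (simp add: \<rho>_def)
    define s where "s = (\<chi> j. (1 / \<rho>) *\<^sub>R (c i j - cinner (A j (w i)) (w i)))"
    have s: "c i j - cinner (A j (w i)) (w i) = \<rho> *\<^sub>R s $ j" for j
      using \<open>\<rho> > 0\<close> by (simp add: s_def)
    have "s \<in> joint_ess_num_range A"
      by (rule joint_ess_num_rangeI[OF F(2) A r_weak[of _ i] r_norm[OF i, folded \<rho>_def] \<open>\<rho> > 0\<close>])
         (use r_lim s in metis)
    then show ?thesis
      using s by (auto simp: \<rho>_def)
  qed
  then obtain s where s: "\<And>i. i < k \<Longrightarrow> s i \<in> joint_ess_num_range A"
    and cs: "\<And>i j. i < k \<Longrightarrow>
      c i j - cinner (A j (w i)) (w i) = (1 - (norm (w i))\<^sup>2) *\<^sub>R s i $ j"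
    by metis
  have "z = (\<Sum>i<k. (\<chi> j. cinner (A j (w i)) (w i)) + (1 - (norm (w i))\<^sup>2) *\<^sub>R s i)"
    unfolding vec_eq_iff zc sum_component
    by (intro allI sum.cong refl) (simp flip: cs)
  moreover have "(\<Sum>i<k. (norm (cinner v (w i)))\<^sup>2) \<le> (norm v)\<^sup>2" for v
  proof (rule tendsto_upperbound[OF _ _ F(2)])
    show "((\<lambda>n. \<Sum>i<k. (norm (cinner v (X n i)))\<^sup>2) \<longlongrightarrow> (\<Sum>i<k. (norm (cinner v (w i)))\<^sup>2)) F"
      by (intro tendsto_intros w)
    have "(\<Sum>i<k. (norm (cinner v (X n i)))\<^sup>2) \<le> (norm v)\<^sup>2" for n
      using bessel[OF x[of n], of v] by (simp add: X_def)
    then show "\<forall>\<^sub>F n in F. (\<Sum>i<k. (norm (cinner v (X n i)))\<^sup>2) \<le> (norm v)\<^sup>2"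
      by simp
  qed
  moreover have "norm (w i) \<le> 1" if "i < k" for i
    using \<rho>_nonneg[OF that] by (simp add: power_le_one_iff abs_square_le_1)
  ultimately show thesis
    using that s by blast
qed

text \<open>In the eigenbasis the contraction inequality puts the weights \<open>t i\<close> in the
  unit interval, and comparing traces fixes the total weight of the essential part. The limit point
  is then a point of a cube whose vertices, one for each set \<open>I\<close> of eigenvectors, lie
  in the hull.\<close>

lemma closure_joint_num_range_subset:
  fixes A :: "'m::finite \<Rightarrow> 'a::chilbert_space \<Rightarrow> 'a"
  assumes dim: "\<not> cfinite_dim TYPE('a)" and A: "\<And>j. bounded_clinear (A j)"
    and sa: "\<And>j. selfadjoint (A j)"
  shows "closure (joint_num_range k A) \<subseteq>
    convex hull (\<Union>l\<in>{0..k}. joint_num_range l A + (\<lambda>s. real (k - l) *\<^sub>R s) ` joint_ess_num_range A)"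
    (is "_ \<subseteq> convex hull ?S")
proof
  fix z assume "z \<in> closure (joint_num_range k A)"
  then obtain w s where
    contr: "\<And>v. (\<Sum>i<k. (norm (cinner v (w i)))\<^sup>2) \<le> (norm v)\<^sup>2"
    and w: "\<And>i. i < k \<Longrightarrow> norm (w i) \<le> 1"
    and s: "\<And>i. i < k \<Longrightarrow> s i \<in> joint_ess_num_range A"
    and z: "z = (\<Sum>i<k. (\<chi> j. cinner (A j (w i)) (w i)) + (1 - (norm (w i))\<^sup>2) *\<^sub>R s i)"
    by (rule closure_joint_num_range_decomposition[where A = A, OF dim A sa]) (rule that)
  obtain l e where e: "l \<le> k" "orthonormal_family l e"
    and diag: "\<And>B. bounded_clinear B \<Longrightarrow> (\<Sum>j<k. cinner (B (w j)) (w j)) =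
      (\<Sum>i<l. (\<Sum>j<k. (norm (cinner (e i) (w j)))\<^sup>2) *\<^sub>R cinner (B (e i)) (e i))"
    by (rule sum_quadratic_form_diagonalization[of k w]) (rule that)
  define t where "t i = (\<Sum>j<k. (norm (cinner (e i) (w j)))\<^sup>2)" for i
  define a where "a i = (\<chi> j. cinner (A j (e i)) (e i))" for i
  have t: "0 \<le> t i \<and> t i \<le> 1" if "i < l" for i
    using contr[of "e i"] orthonormal_family_norm[OF e(2) that]
    by (auto simp: t_def intro: sum_nonneg)
  \<comment> \<open>The diagonalisation applied to the identity operator compares the
    traces.\<close>
  have "complex_of_real (\<Sum>j<k. (norm (w j))\<^sup>2) = complex_of_real (\<Sum>i<l. t i)"
    using diag[of "\<lambda>x. x"] e(2)
    by (simp add: bounded_clinear_def bounded_linear_ident cinner_self t_def orthonormal_family_norm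
        scaleR_conv_of_real)
  then have trace: "(\<Sum>j<k. (norm (w j))\<^sup>2) = (\<Sum>i<l. t i)"
    by (simp only: of_real_eq_iff)
  obtain p where p: "p \<in> convex hull joint_ess_num_range A"
    and ps: "(\<Sum>i<k. (1 - (norm (w i))\<^sup>2) *\<^sub>R s i) = (\<Sum>i<k. 1 - (norm (w i))\<^sup>2) *\<^sub>R p"
    using weighted_sum_in_convex_hull[of "{..<k}" "\<lambda>i. 1 - (norm (w i))\<^sup>2" s "joint_ess_num_range A"]
      w s joint_ess_num_range_nonempty[OF dim, of A] A
    by (auto simp: power_le_one)
  have "(\<Sum>i<k. \<chi> j. cinner (A j (w i)) (w i)) = (\<Sum>i<l. t i *\<^sub>R a i)"
    by (simp add: vec_eq_iff a_def t_def diag[OF A])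
  moreover have "(\<Sum>i<k. 1 - (norm (w i))\<^sup>2) = real (k - l) + (\<Sum>i<l. 1 - t i)"
    using e(1) by (simp add: sum_subtractf trace of_nat_diff)
  ultimately have "z = (\<Sum>i<l. t i *\<^sub>R a i) + (real (k - l) + (\<Sum>i<l. 1 - t i)) *\<^sub>R p"
    unfolding z sum.distrib ps by simp
  then have "z = real (k - l) *\<^sub>R p + (\<Sum>i<l. t i *\<^sub>R a i + (1 - t i) *\<^sub>R p)"
    by (simp add: sum.distrib scaleR_add_left scaleR_sum_left)
  also have "\<dots> \<in> convex hull ?S"
  proof (rule convex_combination_of_vertices)
    fix I assume I: "I \<subseteq> {..<l}"
    define n where "n = card I"
    have n: "n \<le> l"
      using card_mono[OF _ I] by (simp add: n_def)
    define y where "y = (\<Sum>i\<in>I. a i)"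
    have y: "y \<in> joint_num_range n A"
      unfolding y_def a_def n_def by (rule joint_num_range_subfamily[OF e(2) I])
    \<comment> \<open>Pulling the hull back along an affine map gives a convex set containing the
      essential range, hence also \<open>p\<close>, which is known only to lie in its convex
      hull.\<close>
    have "joint_ess_num_range A \<subseteq> (\<lambda>q. y + real (k - n) *\<^sub>R q) -` (convex hull ?S)"
    proof
      fix q assume "q \<in> joint_ess_num_range A"
      then have "y + real (k - n) *\<^sub>R q \<in> ?S"
        using y n e(1) by (intro UN_I[of n] set_plus_intro imageI) auto
      then show "q \<in> (\<lambda>q. y + real (k - n) *\<^sub>R q) -` (convex hull ?S)"
        by (simp add: hull_inc)
    qed
    moreover have "convex ((\<lambda>q. y + real (k - n) *\<^sub>R q) -` (convex hull ?S))"
    proof (rule convexI)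
      fix q q' and u v :: real
      assume q: "q \<in> (\<lambda>q. y + real (k - n) *\<^sub>R q) -` (convex hull ?S)"
        "q' \<in> (\<lambda>q. y + real (k - n) *\<^sub>R q) -` (convex hull ?S)" and uv: "0 \<le> u" "0 \<le> v" "u + v = 1"
      have "u *\<^sub>R (y + real (k - n) *\<^sub>R q) + v *\<^sub>R (y + real (k - n) *\<^sub>R q') \<in> convex hull ?S"
        using q uv by (intro convexD[OF convex_convex_hull]) auto
      also have "u *\<^sub>R (y + real (k - n) *\<^sub>R q) + v *\<^sub>R (y + real (k - n) *\<^sub>R q') =
          (u + v) *\<^sub>R y + real (k - n) *\<^sub>R (u *\<^sub>R q + v *\<^sub>R q')"
        by (simp add: algebra_simps)
      finally show "u *\<^sub>R q + v *\<^sub>R q' \<in> (\<lambda>q. y + real (k - n) *\<^sub>R q) -` (convex hull ?S)"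
        using uv by simp
    qed
    ultimately have "y + real (k - n) *\<^sub>R p \<in> convex hull ?S"
      using hull_minimal[of "joint_ess_num_range A"] p by blast
    moreover have "(\<Sum>i\<in>{..<l} - I. p) = real (l - n) *\<^sub>R p"
      using I finite_subset[OF I] by (simp add: n_def card_Diff_subset scaleR_conv_of_real sum_constant_scaleR)
    moreover have "real (k - n) = real (k - l) + real (l - n)"
      using n e(1) by simp
    ultimately show "real (k - l) *\<^sub>R p + sum a I + (\<Sum>i\<in>{..<l} - I. p) \<in> convex hull ?S"
      by (simp add: y_def scaleR_add_left add_ac)
  qed (use t in auto)
  finally show "z \<in> convex hull ?S" .
qed

section \<open>The closed convex hull and the criterion for closedness\<close>

theorem theorem4p4:
  fixes A :: "'m::finite \<Rightarrow> 'a::chilbert_space \<Rightarrow> 'a" and k :: nat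
  assumes "\<not> cfinite_dim TYPE('a)"
    and "k > 0"
    and "\<And>j. bounded_clinear (A j)"
    and "\<And>j. selfadjoint (A j)"
  shows "closure (convex hull (joint_num_range k A)) = convex hull (closure (joint_num_range k A))
    \<and> convex hull (closure (joint_num_range k A)) =
        convex hull (\<Union>l\<in>{0..k}. joint_num_range l A
                       + (\<lambda>s. real (k - l) *\<^sub>R s) ` joint_ess_num_range A)
    \<and> (closed (convex hull (joint_num_range k A)) \<longleftrightarrow>
        (\<forall>l<k. joint_num_range l A + (\<lambda>s. real (k - l) *\<^sub>R s) ` joint_ess_num_range A
                 \<subseteq> convex hull (joint_num_range k A)))"
proof -
  define W where "W = joint_num_range k A"
  define T where "T l = joint_num_range l A + (\<lambda>s. real (k - l) *\<^sub>R s) ` joint_ess_num_range A" for l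
  define S where "S = (\<Union>l\<in>{0..k}. T l)"
  have "bounded W"
    unfolding W_def using assms(3) by (rule bounded_joint_num_range)
  \<comment> \<open>The values lie in a finite-dimensional space, where the convex hull of a compact
    set is compact and so closed.\<close>
  then have "compact (convex hull (closure W))"
    by (simp add: compact_convex_hull compact_closure)
  then have "closure (convex hull W) \<subseteq> convex hull (closure W)"
    by (intro closure_minimal compact_imp_closed hull_mono closure_subset)
  moreover have "convex hull (closure W) \<subseteq> closure (convex hull W)"
    by (intro hull_minimal closure_mono hull_subset convex_closure convex_convex_hull)
  ultimately have eq1: "closure (convex hull W) = convex hull (closure W)"
    by blast
  have "closure W \<subseteq> convex hull S"
    unfolding W_def S_def T_def using assms(1,3,4) by (rule closure_joint_num_range_subset)
  moreover have "T l \<subseteq> closure (convex hull W)" if l: "l \<le> k" for l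
  proof
    fix y assume "y \<in> T l"
    then obtain x s where "orthonormal_family l x" "s \<in> joint_ess_num_range A"
      "y = (\<chi> j. \<Sum>i<l. cinner (A j (x i)) (x i)) + real (k - l) *\<^sub>R s"
      by (auto simp: T_def set_plus_def joint_num_range_def)
    then show "y \<in> closure (convex hull W)"
      using orthonormal_plus_ess_in_closure[where A = A, OF assms(1,3), of s l x "k - l"] l
      by (simp add: W_def)
  qed
  ultimately have eq2: "convex hull (closure W) = convex hull S"
    unfolding eq1 S_def by (intro equalityI hull_minimal convex_convex_hull UN_least) simp_all
  \<comment> \<open>For \<open>l = k\<close> the essential range is scaled by 0; being nonempty it
    becomes the set of 0 alone, and the Minkowski sum leaves \<open>W\<close> unchanged.\<close>
  obtain s0 where "s0 \<in> joint_ess_num_range A"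
    using joint_ess_num_range_nonempty[OF assms(1), of A] assms(3) by blast
  then have "T k = W"
    by (auto simp: T_def W_def set_plus_def)
  have "closed (convex hull W) \<longleftrightarrow> S \<subseteq> convex hull W"
  proof
    assume "closed (convex hull W)"
    then have "convex hull W = convex hull S"
      using eq1 eq2 by (metis closure_closed)
    then show "S \<subseteq> convex hull W"
      by (simp add: hull_subset)
  next
    assume "S \<subseteq> convex hull W"
    then have "convex hull S \<subseteq> convex hull W"
      by (intro hull_minimal convex_convex_hull)
    then have "closure (convex hull W) \<subseteq> convex hull W"
      unfolding eq1 eq2 .
    then show "closed (convex hull W)"
      by (metis closure_subset closed_closure subset_antisym)
  qed
  \<comment> \<open>The term \<open>l = k\<close> is \<open>W\<close> itself, so only the terms with
    \<open>l < k\<close> carry a condition.\<close>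
  moreover have "S \<subseteq> convex hull W \<longleftrightarrow> (\<forall>l<k. T l \<subseteq> convex hull W)"
  proof -
    have "S = W \<union> (\<Union>l\<in>{..<k}. T l)"
      using \<open>T k = W\<close> by (simp add: S_def atLeast0AtMost flip: lessThan_Suc_atMost)
         (simp add: lessThan_Suc)
    then show ?thesis
      by (simp add: hull_subset UN_subset_iff Ball_def)
  qed
  ultimately have "closed (convex hull W) \<longleftrightarrow> (\<forall>l<k. T l \<subseteq> convex hull W)"
    by (rule trans)
  with eq1 eq2 show ?thesis
    unfolding W_def S_def T_def by (intro conjI)
qed

end
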